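(* Let $n\ge2$ be an integer and let $$G=\Big\{(\overline{k}_1,\dots,\overline{k}_n)\in(\mathbb{Z}/3\mathbb{Z})^n:\ \overline{k}_1+\dots+\overline{k}_n=\overline{0}\Big\}$$ act by algebra automorphisms on $S=\mathbb{C}[x_1,\dots,x_n,y_1,\dots,y_n]$ and on the Weyl algebra $A=A_n(\mathbb{C})$ by $$(\overline{k}_1,\dots,\overline{k}_n).x_i=\zeta^{k_i}x_i,\quad (\overline{k}_1,\dots,\overline{k}_n).y_i=\zeta^{-k_i}y_i,\quad (\overline{k}_1,\dots,\overline{k}_n).p_i=\zeta^{k_i}p_i,\quad (\overline{k}_1,\dots,\overline{k}_n).q_i=\zeta^{-k_i}q_i,$$ where $\zeta=e^{2i\pi/3}$. Then $$\dim_{\mathbb{C}}HP_0(S^G)=2^n-2,\qquad \dim_{\mathbb{C}}HH_0(A^G)=\frac23\left(2^{n-1}-(-1)^{n-1}\right).$$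
   Context: $S$ carries the standard Poisson bracket $\{x_i,y_j\}=\delta_{ij}$, $\{x_i,x_j\}=\{y_i,y_j\}=0$, for which $G$ acts by Poisson automorphisms. $A_n(\mathbb{C})$ is the Weyl algebra generated by $p_1,\dots,p_n,q_1,\dots,q_n$ with $[p_i,q_j]=\delta_{ij}$, $[p_i,p_j]=[q_i,q_j]=0$. $S^G$, $A^G$ are the invariant algebras. $HP_0(S^G)=S^G/\{S^G,S^G\}$ and $HH_0(A^G)=A^G/[A^G,A^G]$, where $\{S^G,S^G\}$ and $[A^G,A^G]$ denote the linear spans of the brackets, respectively commutators. *)

theory Defs
  imports Complex_Main "HOL-Library.Poly_Mapping" "HOL-Library.Numeral_Type"
begin

section \<open>Monoid algebras over the complex numbers\<close>

text \<open>
  For a monoid \<open>'k\<close> (written additively), \<open>'k \<Rightarrow>\<^sub>0 complex\<close> with the convolution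
  product of \<^theory>\<open>HOL-Library.Poly_Mapping\<close> is the monoid algebra.  Commutative polynomials
  arise from the monoid of exponent vectors, noncommutative ones from the monoid of words.
\<close>

definition scaleP :: "complex \<Rightarrow> ('k::monoid_add \<Rightarrow>\<^sub>0 complex) \<Rightarrow> ('k \<Rightarrow>\<^sub>0 complex)"
  where "scaleP c f = Poly_Mapping.single 0 c * f"

lemma lookup_scaleP [simp]: "Poly_Mapping.lookup (scaleP c f) m = c * Poly_Mapping.lookup f m"
proof -
  have "scaleP c f = Poly_Mapping.map ((*) c) f"
    by (simp add: scaleP_def mult_map_scale_conv_mult)
  then show ?thesis
    by (simp add: Poly_Mapping.map.rep_eq when_def)
qed

interpretation cpoly: vector_space "scaleP :: complex \<Rightarrow> ('k::monoid_add \<Rightarrow>\<^sub>0 complex) \<Rightarrow> _"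
  by unfold_locales (auto intro!: poly_mapping_eqI simp: lookup_add algebra_simps)

lemma scaleP_mult_left: "scaleP c f * g = scaleP c (f * g)"
  by (simp add: scaleP_def mult.assoc)

lemma sum_single_keys: "f = (\<Sum>m\<in>Poly_Mapping.keys f. Poly_Mapping.single m (Poly_Mapping.lookup f m))"
  by (rule poly_mapping_eqI)
     (simp add: lookup_sum lookup_single when_def sum.delta' in_keys_iff)

lemma scaleP_central: "Poly_Mapping.single 0 c * f = f * Poly_Mapping.single 0 (c::complex)"
  for f :: "'k::monoid_add \<Rightarrow>\<^sub>0 complex"
  by (subst (1 2) sum_single_keys[of f])
     (simp add: sum_distrib_left sum_distrib_right mult_single mult.commute)

lemma scaleP_mult_right: "f * scaleP c g = scaleP c (f * g)"
  by (metis scaleP_def scaleP_central mult.assoc)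

definition lin_ext ::
    "('m \<Rightarrow> ('k::monoid_add \<Rightarrow>\<^sub>0 complex)) \<Rightarrow> ('m \<Rightarrow>\<^sub>0 complex) \<Rightarrow> ('k \<Rightarrow>\<^sub>0 complex)"
  where "lin_ext \<phi> f = (\<Sum>m\<in>Poly_Mapping.keys f. scaleP (Poly_Mapping.lookup f m) (\<phi> m))"

lemma lin_ext_superset:
  "finite A \<Longrightarrow> Poly_Mapping.keys f \<subseteq> A \<Longrightarrow> lin_ext \<phi> f = (\<Sum>m\<in>A. scaleP (Poly_Mapping.lookup f m) (\<phi> m))"
  unfolding lin_ext_def by (rule sum.mono_neutral_left) (auto simp: in_keys_iff)

lemma lin_ext_0 [simp]: "lin_ext \<phi> 0 = 0"
  by (simp add: lin_ext_def)

lemma lin_ext_add: "lin_ext \<phi> (f + g) = lin_ext \<phi> f + lin_ext \<phi> g"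
proof -
  have "lin_ext \<phi> h = (\<Sum>m\<in>Poly_Mapping.keys f \<union> Poly_Mapping.keys g. scaleP (Poly_Mapping.lookup h m) (\<phi> m))"
    if "Poly_Mapping.keys h \<subseteq> Poly_Mapping.keys f \<union> Poly_Mapping.keys g" for h
    using that by (intro lin_ext_superset) auto
  then show ?thesis
    using keys_add[of f g]
    by (simp add: lookup_add cpoly.scale_left_distrib sum.distrib)
qed

lemma lin_ext_single [simp]: "lin_ext \<phi> (Poly_Mapping.single m c) = scaleP c (\<phi> m)"
  by (subst lin_ext_superset[of "{m}"]) auto

lemma lin_ext_scale: "lin_ext \<phi> (scaleP c f) = scaleP c (lin_ext \<phi> f)"
proof -
  have "lin_ext \<phi> (scaleP c f) = (\<Sum>m\<in>Poly_Mapping.keys f. scaleP (Poly_Mapping.lookup (scaleP c f) m) (\<phi> m))"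
    by (rule lin_ext_superset) (auto simp: in_keys_iff)
  then show ?thesis
    by (simp add: lin_ext_def cpoly.scale_sum_right)
qed

lemma lin_ext_uminus: "lin_ext \<phi> (- f) = - lin_ext \<phi> f"
  by (metis add_eq_0_iff lin_ext_0 lin_ext_add neg_eq_iff_add_eq_0)

lemma lin_ext_diff: "lin_ext \<phi> (f - g) = lin_ext \<phi> f - lin_ext \<phi> g"
  by (metis (no_types) diff_conv_add_uminus lin_ext_add lin_ext_uminus)

lemma lin_ext_sum: "lin_ext \<phi> (sum F A) = (\<Sum>a\<in>A. lin_ext \<phi> (F a))"
  by (induction A rule: infinite_finite_induct) (auto simp: lin_ext_add)

lemma lin_ext_mult:
  fixes \<phi> :: "'m::monoid_add \<Rightarrow> ('k::monoid_add \<Rightarrow>\<^sub>0 complex)"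
  assumes "\<And>a b. \<phi> (a + b) = \<phi> a * \<phi> b"
  shows "lin_ext \<phi> (f * g) = lin_ext \<phi> f * lin_ext \<phi> g"
proof -
  have "f * g = (\<Sum>m\<in>Poly_Mapping.keys f. \<Sum>n\<in>Poly_Mapping.keys g.
      Poly_Mapping.single (m + n) (Poly_Mapping.lookup f m * Poly_Mapping.lookup g n))"
    by (subst sum_single_keys[of f], subst sum_single_keys[of g])
       (simp add: sum_product mult_single)
  then have "lin_ext \<phi> (f * g) = (\<Sum>m\<in>Poly_Mapping.keys f. \<Sum>n\<in>Poly_Mapping.keys g.
      scaleP (Poly_Mapping.lookup f m) (\<phi> m) * scaleP (Poly_Mapping.lookup g n) (\<phi> n))"
    by (simp add: lin_ext_sum assms scaleP_mult_left scaleP_mult_right mult.commute)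
  then show ?thesis
    by (simp add: lin_ext_def sum_product)
qed


section \<open>The group and its characters\<close>

text \<open>The numeral type \<open>3\<close> is the ring of integers modulo 3, and \<open>Rep_bit1\<close> maps a
  residue class to its representative in \<open>{0, 1, 2}\<close>.  The lemma
  \<open>zeta_powi_representative\<close> shows that the choice of representative is immaterial.\<close>

definition zeta :: complex where "zeta = exp (2 * \<i> * of_real pi / 3)"

lemma zeta_cubed: "zeta ^ 3 = 1"
proof -
  have "zeta ^ 3 = exp (\<i> * of_real (2 * pi))"
    by (simp add: zeta_def mult_ac flip: exp_of_nat_mult)
  then show ?thesis
    by (simp only: cis_2pi flip: cis_conv_exp)
qed

lemma zeta_nonzero [simp]: "zeta \<noteq> 0"
  by (simp add: zeta_def)

lemma zeta_powi_representative: "zeta powi Rep_bit1 (of_int z :: 3) = zeta powi z"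
proof -
  have "Rep_bit1 (of_int z :: 3) = z mod 3"
    using bit1.Rep_Abs_mod[of z, where 'a = num1] by (simp add: bit1.of_int_eq)
  moreover have "zeta powi z = zeta powi (3 * (z div 3) + z mod 3)"
    by simp
  then have "zeta powi z = (zeta powi 3) powi (z div 3) * zeta powi (z mod 3)"
    by (metis power_int_add power_int_mult zeta_nonzero)
  ultimately show ?thesis
    by (simp add: zeta_cubed)
qed

definition grp :: "('n::finite \<Rightarrow> 3) set"
  where "grp = {k. (\<Sum>i\<in>UNIV. k i) = 0}"


section \<open>The polynomial algebra\<close>

datatype 'n pvar = X 'n | Y 'n

instance pvar :: (finite) finite
proof
  have "(UNIV :: 'a pvar set) = Set.range X \<union> Set.range Y"
    by (metis UNIV_eq_I UnCI pvar.exhaust rangeI)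
  then show "finite (UNIV :: 'a pvar set)"
    by (metis finite_UnI finite_class.finite_UNIV finite_imageI)
qed

type_synonym 'n cpol = "('n pvar \<Rightarrow>\<^sub>0 nat) \<Rightarrow>\<^sub>0 complex"

definition pv :: "'n pvar \<Rightarrow> 'n cpol"
  where "pv v = Poly_Mapping.single (Poly_Mapping.single v 1) 1"

definition psubst :: "('n::finite pvar \<Rightarrow> 'n cpol) \<Rightarrow> 'n cpol \<Rightarrow> 'n cpol"
  where "psubst \<sigma> = lin_ext (\<lambda>m. \<Prod>v\<in>UNIV. \<sigma> v ^ Poly_Mapping.lookup m v)"

lemma psubst_mult: "psubst \<sigma> (f * g) = psubst \<sigma> f * psubst \<sigma> g"
  unfolding psubst_def
  by (rule lin_ext_mult) (simp add: lookup_add power_add prod.distrib)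

lemma psubst_pv [simp]: "psubst \<sigma> (pv v) = \<sigma> v"
proof -
  have "(\<Prod>w\<in>UNIV. \<sigma> w ^ Poly_Mapping.lookup (Poly_Mapping.single v (1::nat)) w)
      = (\<Prod>w\<in>UNIV. if w = v then \<sigma> w else 1)"
    by (rule prod.cong) (auto simp: lookup_single when_def)
  then show ?thesis
    by (simp add: psubst_def pv_def)
qed

text \<open>The partial derivative.  The truncated subtraction is harmless, as the coefficient is 0
  when the variable does not occur in \<open>m\<close>.\<close>

definition pdiff :: "'n pvar \<Rightarrow> 'n cpol \<Rightarrow> 'n cpol"
  where "pdiff v =
    lin_ext (\<lambda>m. Poly_Mapping.single (m - Poly_Mapping.single v 1) (of_nat (Poly_Mapping.lookup m v)))"

lemma pdiff_pv: "pdiff v (pv w) = (if v = w then 1 else 0)"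
  by (auto simp: pdiff_def pv_def lookup_single)

lemma pdiff_mult: "pdiff v (f * g) = pdiff v f * g + f * pdiff v g"
proof -
  let ?s = "Poly_Mapping.single :: ('a pvar \<Rightarrow>\<^sub>0 nat) \<Rightarrow> complex \<Rightarrow> 'a cpol"
  have shift: "?s (m + n - Poly_Mapping.single v 1) (of_nat (Poly_Mapping.lookup m v) * c) =
      ?s (m - Poly_Mapping.single v 1 + n) (of_nat (Poly_Mapping.lookup m v) * c)" for m n c
  proof (cases "Poly_Mapping.lookup m v = 0")
    case False
    then have "m + n - Poly_Mapping.single v 1 = m - Poly_Mapping.single v 1 + n"
      by (intro poly_mapping_eqI) (auto simp: lookup_add lookup_minus lookup_single when_def)
    then show ?thesis by simp
  qed simp
  have scale: "scaleP c (?s m d) = ?s m (c * d)" for m c d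
    by (simp add: scaleP_def mult_single)
  have mono: "pdiff v (?s m a * ?s n b) = pdiff v (?s m a) * ?s n b + ?s m a * pdiff v (?s n b)"
    for m n a b
    using shift[of m n "a * b"] shift[of n m "a * b"]
    by (simp add: pdiff_def mult_single scale lookup_add algebra_simps single_add)
  have sums: "pdiff v (\<Sum>m\<in>A. F m) = (\<Sum>m\<in>A. pdiff v (F m))"
    for F :: "('a pvar \<Rightarrow>\<^sub>0 nat) \<Rightarrow> 'a cpol" and A
    by (simp add: pdiff_def lin_ext_sum)
  have "pdiff v ((\<Sum>m\<in>A. ?s m (p m)) * (\<Sum>n\<in>B. ?s n (q n))) =
      pdiff v (\<Sum>m\<in>A. ?s m (p m)) * (\<Sum>n\<in>B. ?s n (q n))
      + (\<Sum>m\<in>A. ?s m (p m)) * pdiff v (\<Sum>n\<in>B. ?s n (q n))" for A B p q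
    by (simp add: sum_product sums mono sum.distrib)
  from this[of "Poly_Mapping.lookup f" "Poly_Mapping.keys f"
      "Poly_Mapping.lookup g" "Poly_Mapping.keys g"]
  show ?thesis
    by (simp only: sum_single_keys[symmetric])
qed

definition poisson :: "'n::finite cpol \<Rightarrow> 'n cpol \<Rightarrow> 'n cpol"
  where "poisson f g =
    (\<Sum>i\<in>UNIV. pdiff (X i) f * pdiff (Y i) g - pdiff (Y i) f * pdiff (X i) g)"

lemma poisson_generators:
  "poisson (pv (X i)) (pv (Y j)) = (if i = j then 1 else 0)"
  "poisson (pv (X i)) (pv (X j)) = 0"
  "poisson (pv (Y i)) (pv (Y j)) = 0"
proof -
  have "poisson (pv (X i)) (pv (Y j)) = (\<Sum>l\<in>UNIV. if l = i then (if i = j then 1 else 0) else 0)"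
    unfolding poisson_def by (rule sum.cong) (auto simp: pdiff_pv)
  then show "poisson (pv (X i)) (pv (Y j)) = (if i = j then 1 else 0)" by simp
qed (simp_all add: poisson_def pdiff_pv)

definition actS :: "('n::finite \<Rightarrow> 3) \<Rightarrow> 'n cpol \<Rightarrow> 'n cpol"
  where "actS k = psubst (\<lambda>v. case v of
      X i \<Rightarrow> scaleP (zeta powi Rep_bit1 (k i)) (pv (X i))
    | Y i \<Rightarrow> scaleP (zeta powi (- Rep_bit1 (k i))) (pv (Y i)))"

definition invS :: "'n::finite cpol set"
  where "invS = {f. \<forall>k\<in>grp. actS k f = f}"

definition poisson_span :: "'n::finite cpol set"
  where "poisson_span = cpoly.span {poisson f g | f g. f \<in> invS \<and> g \<in> invS}"

lemma subspace_invS: "cpoly.subspace invS"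
  unfolding cpoly.subspace_def invS_def actS_def psubst_def
  by (simp add: lin_ext_add lin_ext_scale)


section \<open>The Weyl algebra\<close>

text \<open>The Weyl algebra is the free algebra on the \<open>P i\<close>, \<open>Q i\<close> modulo the two-sided ideal
  generated by the canonical commutation relations.\<close>

datatype 'a word = Word (letters: "'a list")

instantiation word :: (type) monoid_add
begin

definition zero_word :: "'a word" where "0 = Word []"

definition plus_word :: "'a word \<Rightarrow> 'a word \<Rightarrow> 'a word"
  where "u + v = Word (letters u @ letters v)"

instance
  by standard (simp_all add: zero_word_def plus_word_def)

end

datatype 'n wgen = P 'n | Q 'n

type_synonym 'n free_alg = "'n wgen word \<Rightarrow>\<^sub>0 complex"

definition fv :: "'n wgen \<Rightarrow> 'n free_alg"
  where "fv g = Poly_Mapping.single (Word [g]) 1"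

definition fsubst :: "('n wgen \<Rightarrow> 'n free_alg) \<Rightarrow> 'n free_alg \<Rightarrow> 'n free_alg"
  where "fsubst \<sigma> = lin_ext (\<lambda>w. prod_list (map \<sigma> (letters w)))"

lemma fsubst_mult: "fsubst \<sigma> (f * g) = fsubst \<sigma> f * fsubst \<sigma> g"
  unfolding fsubst_def by (rule lin_ext_mult) (simp add: plus_word_def)

lemma fsubst_fv [simp]: "fsubst \<sigma> (fv g) = \<sigma> g"
  by (simp add: fsubst_def fv_def)

lemma fsubst_1 [simp]: "fsubst \<sigma> 1 = 1"
  by (simp add: fsubst_def zero_word_def flip: single_one)

definition commutator :: "'a::ring \<Rightarrow> 'a \<Rightarrow> 'a"
  where "commutator a b = a * b - b * a"

definition weyl_relators :: "'n free_alg set"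
  where "weyl_relators =
      {commutator (fv (P i)) (fv (Q j)) - (if i = j then 1 else 0) | i j. True}
    \<union> {commutator (fv (P i)) (fv (P j)) | i j. True}
    \<union> {commutator (fv (Q i)) (fv (Q j)) | i j. True}"

definition weyl_ideal :: "'n free_alg set"
  where "weyl_ideal = cpoly.span {a * r * b | a r b. r \<in> weyl_relators}"

lemma weyl_ideal_mult:
  assumes "z \<in> weyl_ideal"
  shows "a * z \<in> weyl_ideal" and "z * a \<in> weyl_ideal"
proof -
  have "a * z \<in> weyl_ideal \<and> z * a \<in> weyl_ideal"
    using assms unfolding weyl_ideal_def
  proof (induction rule: cpoly.span_induct_alt)
    case base
    then show ?case by (simp add: cpoly.span_zero)
  next
    case (step c x y)
    then obtain u r v where r: "r \<in> weyl_relators" "x = u * r * v" by blast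
    have "a * x = (a * u) * r * v" "x * a = u * r * (v * a)"
      using r by (simp_all add: mult.assoc)
    with r have "a * x \<in> {a * r * b | a r b. r \<in> weyl_relators}"
      "x * a \<in> {a * r * b | a r b. r \<in> weyl_relators}" by blast+
    with step show ?case
      by (simp add: distrib_left distrib_right scaleP_mult_left scaleP_mult_right
          cpoly.span_add cpoly.span_scale cpoly.span_base)
  qed
  then show "a * z \<in> weyl_ideal" and "z * a \<in> weyl_ideal" by auto
qed

lemma subspace_weyl_ideal: "cpoly.subspace weyl_ideal"
  by (simp add: weyl_ideal_def)

lemmas weyl_ideal_closed = cpoly.subspace_0[OF subspace_weyl_ideal]
  cpoly.subspace_add[OF subspace_weyl_ideal] cpoly.subspace_diff[OF subspace_weyl_ideal]
  cpoly.subspace_neg[OF subspace_weyl_ideal] cpoly.subspace_scale[OF subspace_weyl_ideal]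

definition weyl_rel :: "'n free_alg \<Rightarrow> 'n free_alg \<Rightarrow> bool"
  where "weyl_rel a b \<longleftrightarrow> a - b \<in> weyl_ideal"

lemma weyl_rel_refl [simp]: "weyl_rel a a"
  by (simp add: weyl_rel_def weyl_ideal_closed)

lemma equivp_weyl_rel: "equivp (weyl_rel :: 'n free_alg \<Rightarrow> _)"
proof (rule equivpI)
  show "reflp (weyl_rel :: 'n free_alg \<Rightarrow> _)"
    by (simp add: reflp_def)
  show "symp (weyl_rel :: 'n free_alg \<Rightarrow> _)"
  proof (rule sympI)
    fix a b :: "'n free_alg"
    assume "weyl_rel a b"
    then show "weyl_rel b a"
      using weyl_ideal_closed(4)[of "a - b"] by (simp add: weyl_rel_def)
  qed
  show "transp (weyl_rel :: 'n free_alg \<Rightarrow> _)"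
  proof (rule transpI)
    fix a b c :: "'n free_alg"
    assume "weyl_rel a b" "weyl_rel b c"
    then show "weyl_rel a c"
      using weyl_ideal_closed(2)[of "a - b" "b - c"] by (simp add: weyl_rel_def)
  qed
qed

quotient_type 'n weyl = "'n free_alg" / weyl_rel
  by (rule equivp_weyl_rel)

instantiation weyl :: (type) ring
begin

lift_definition zero_weyl :: "'a weyl" is 0 .

lift_definition plus_weyl :: "'a weyl \<Rightarrow> 'a weyl \<Rightarrow> 'a weyl" is "(+)"
  by (simp add: weyl_rel_def add_diff_add weyl_ideal_closed(2))

lift_definition uminus_weyl :: "'a weyl \<Rightarrow> 'a weyl" is uminus
  by (simp only: weyl_rel_def minus_diff_minus weyl_ideal_closed(4))

lift_definition minus_weyl :: "'a weyl \<Rightarrow> 'a weyl \<Rightarrow> 'a weyl" is "(-)"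
proof -
  fix a b c d :: "'a free_alg"
  assume "weyl_rel a b" "weyl_rel c d"
  moreover have "a - c - (b - d) = (a - b) - (c - d)" by simp
  ultimately show "weyl_rel (a - c) (b - d)"
    by (simp only: weyl_rel_def weyl_ideal_closed(3))
qed

lift_definition times_weyl :: "'a weyl \<Rightarrow> 'a weyl \<Rightarrow> 'a weyl" is "(*)"
proof -
  fix a a' b b' :: "'a free_alg"
  assume "weyl_rel a a'" "weyl_rel b b'"
  moreover have "a * b - a' * b' = (a - a') * b + a' * (b - b')"
    by (simp add: algebra_simps)
  ultimately show "weyl_rel (a * b) (a' * b')"
    by (simp add: weyl_rel_def weyl_ideal_closed(2) weyl_ideal_mult)
qed

instance
  by standard (transfer; simp add: algebra_simps)+

end

instantiation weyl :: (type) monoid_mult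
begin

lift_definition one_weyl :: "'a weyl" is 1 .

instance
  by standard (transfer; simp)+

end

lift_definition scaleA :: "complex \<Rightarrow> 'n weyl \<Rightarrow> 'n weyl" is scaleP
  by (simp add: weyl_rel_def weyl_ideal_closed(5) flip: cpoly.scale_right_diff_distrib)

interpretation weyl: vector_space "scaleA :: complex \<Rightarrow> 'n weyl \<Rightarrow> 'n weyl"
  by unfold_locales (transfer; simp add: cpoly.scale_left_distrib cpoly.scale_right_distrib)+

lift_definition wv :: "'n wgen \<Rightarrow> 'n weyl" is fv .

lemma weyl_generators:
  "commutator (wv (P i)) (wv (Q j)) = (if i = j then 1 else 0)"
  "commutator (wv (P i)) (wv (P j)) = 0"
  "commutator (wv (Q i)) (wv (Q j)) = 0"
proof -
  have R: "r \<in> weyl_ideal" if "r \<in> weyl_relators" for r :: "'a free_alg"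
  proof -
    have "r = 1 * r * 1" by simp
    with that have "r \<in> {a * r * b | a r b. r \<in> weyl_relators}" by blast
    then show ?thesis
      unfolding weyl_ideal_def by (rule cpoly.span_base)
  qed
  show "commutator (wv (P i)) (wv (Q j)) = (if i = j then 1 else 0)"
  proof (cases "i = j")
    case True
    have "commutator (fv (P i)) (fv (Q j)) - 1 \<in> weyl_ideal"
      by (rule R) (use True in \<open>auto simp: weyl_relators_def\<close>)
    then show ?thesis using True
      unfolding commutator_def by simp (transfer, simp add: weyl_rel_def)
  next
    case False
    have "commutator (fv (P i)) (fv (Q j)) - (if i = j then 1 else 0) \<in> weyl_ideal"
      by (rule R) (unfold weyl_relators_def, blast)
    then show ?thesis using False
      unfolding commutator_def by simp (transfer, simp add: weyl_rel_def)
  qed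
  have "commutator (fv (P i)) (fv (P j)) \<in> weyl_ideal"
    by (rule R) (auto simp: weyl_relators_def)
  then show "commutator (wv (P i)) (wv (P j)) = 0"
    unfolding commutator_def by transfer (simp add: weyl_rel_def)
  have "commutator (fv (Q i)) (fv (Q j)) \<in> weyl_ideal"
    by (rule R) (auto simp: weyl_relators_def)
  then show "commutator (wv (Q i)) (wv (Q j)) = 0"
    unfolding commutator_def by transfer (simp add: weyl_rel_def)
qed

definition act_free :: "('n \<Rightarrow> 3) \<Rightarrow> 'n free_alg \<Rightarrow> 'n free_alg"
  where "act_free k = fsubst (\<lambda>g. case g of
      P i \<Rightarrow> scaleP (zeta powi Rep_bit1 (k i)) (fv (P i))
    | Q i \<Rightarrow> scaleP (zeta powi (- Rep_bit1 (k i))) (fv (Q i)))"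

lemma act_free_relators:
  assumes "r \<in> weyl_relators"
  shows "\<exists>c. act_free k r = scaleP c r"
proof -
  have D: "act_free k (f - g) = act_free k f - act_free k g" for f g
    by (simp add: act_free_def fsubst_def lin_ext_diff)
  have M: "act_free k (f * g) = act_free k f * act_free k g" for f g
    by (simp add: act_free_def fsubst_mult)
  have C: "act_free k (commutator (fv g) (fv h)) =
      scaleP (a * b) (commutator (fv g) (fv h))"
    if "act_free k (fv g) = scaleP a (fv g)" "act_free k (fv h) = scaleP b (fv h)" for g h a b
    by (simp add: commutator_def D M that scaleP_mult_left scaleP_mult_right
        cpoly.scale_right_diff_distrib mult.commute)
  have gens: "act_free k (fv (P i)) = scaleP (zeta powi Rep_bit1 (k i)) (fv (P i))"
    "act_free k (fv (Q i)) = scaleP (zeta powi (- Rep_bit1 (k i))) (fv (Q i))" for i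
    by (simp_all add: act_free_def)
  from assms consider i j where "i \<noteq> j" "r = commutator (fv (P i)) (fv (Q j))"
    | i where "r = commutator (fv (P i)) (fv (Q i)) - 1"
    | i j where "r = commutator (fv (P i)) (fv (P j))"
    | i j where "r = commutator (fv (Q i)) (fv (Q j))"
    unfolding weyl_relators_def by (fastforce split: if_splits)
  then show ?thesis
  proof cases
    case 2
    have "act_free k r = scaleP 1 r"
      unfolding 2 D C[OF gens] by (simp add: act_free_def flip: power_int_add)
    then show ?thesis by blast
  qed (use C gens in blast)+
qed

lemma act_free_ideal:
  assumes "z \<in> weyl_ideal"
  shows "act_free k z \<in> weyl_ideal"
  using assms unfolding weyl_ideal_def
proof (induction rule: cpoly.span_induct_alt)
  case base
  then show ?case by (simp add: act_free_def fsubst_def cpoly.span_zero)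
next
  case (step c x y)
  then obtain u r v where r: "r \<in> weyl_relators" "x = u * r * v" by blast
  obtain d where "act_free k r = scaleP d r"
    using act_free_relators r(1) by blast
  then have "act_free k x = scaleP d (act_free k u * r * act_free k v)"
    by (simp add: r(2) act_free_def fsubst_mult scaleP_mult_left scaleP_mult_right)
  moreover have "act_free k u * r * act_free k v \<in> {a * r * b | a r b. r \<in> weyl_relators}"
    using r(1) by blast
  moreover have "act_free k (scaleP c x + y) = scaleP c (act_free k x) + act_free k y"
    by (simp add: act_free_def fsubst_def lin_ext_add lin_ext_scale)
  ultimately show ?case
    using step by (simp add: cpoly.span_add cpoly.span_scale cpoly.span_base)
qed

lift_definition actA :: "('n \<Rightarrow> 3) \<Rightarrow> 'n weyl \<Rightarrow> 'n weyl" is act_free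
proof -
  fix k :: "'n \<Rightarrow> 3" and a b :: "'n free_alg"
  assume "weyl_rel a b"
  then have "act_free k (a - b) \<in> weyl_ideal"
    by (simp add: weyl_rel_def act_free_ideal)
  then show "weyl_rel (act_free k a) (act_free k b)"
    by (simp add: weyl_rel_def act_free_def fsubst_def lin_ext_diff)
qed

lemma actA_algebra_hom:
  "actA k (a + b) = actA k a + actA k b"
  "actA k (a * b) = actA k a * actA k b"
  "actA k 1 = 1"
  "actA k (scaleA c a) = scaleA c (actA k a)"
  by (transfer, simp add: act_free_def fsubst_def lin_ext_add,
      transfer, simp add: act_free_def fsubst_mult,
      transfer, simp add: act_free_def,
      transfer, simp add: act_free_def fsubst_def lin_ext_scale)

lemma actA_generators:
  "actA k (wv (P i)) = scaleA (zeta powi Rep_bit1 (k i)) (wv (P i))"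
  "actA k (wv (Q i)) = scaleA (zeta powi (- Rep_bit1 (k i))) (wv (Q i))"
  by (transfer, simp add: act_free_def)+

definition invA :: "'n::finite weyl set"
  where "invA = {a. \<forall>k\<in>grp. actA k a = a}"

definition commutator_span :: "'n::finite weyl set"
  where "commutator_span = weyl.span {commutator a b | a b. a \<in> invA \<and> b \<in> invA}"

lemma subspace_invA: "weyl.subspace (invA :: 'a::finite weyl set)"
proof -
  have "actA k 0 = 0" for k :: "'a \<Rightarrow> 3"
    by (metis actA_algebra_hom(1) add_cancel_right_right)
  then show ?thesis
    unfolding weyl.subspace_def invA_def by (simp add: actA_algebra_hom)
qed


section \<open>The quotient spaces\<close>

text \<open>Both are quotients of the invariants by a subspace, formed as partial quotients of the
  ambient algebra.  Note that \<open>dim\<close> is 0 for infinite-dimensional spaces, so a positive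
  value of \<open>dim\<close> entails finite dimension.\<close>

lemma part_equivp_quotient:
  assumes "vector_space scl" "module.subspace scl V" "module.subspace scl W"
  shows "part_equivp (\<lambda>u v. u \<in> V \<and> v \<in> V \<and> u - v \<in> W)"
proof -
  interpret vector_space scl by fact
  show ?thesis
  proof (rule part_equivpI)
    show "\<exists>u. u \<in> V \<and> u \<in> V \<and> u - u \<in> W"
      using assms by (auto intro: subspace_0)
    show "symp (\<lambda>u v. u \<in> V \<and> v \<in> V \<and> u - v \<in> W)"
      using assms(3) by (auto simp: symp_def dest: subspace_neg)
    show "transp (\<lambda>u v. u \<in> V \<and> v \<in> V \<and> u - v \<in> W)"
    proof (rule transpI)
      fix u v w
      assume "u \<in> V \<and> v \<in> V \<and> u - v \<in> W" "v \<in> V \<and> w \<in> V \<and> v - w \<in> W"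
      then show "u \<in> V \<and> w \<in> V \<and> u - w \<in> W"
        using subspace_add[OF assms(3), of "u - v" "v - w"] by simp
    qed
  qed
qed

definition HP0_rel :: "'n::finite cpol \<Rightarrow> 'n cpol \<Rightarrow> bool"
  where "HP0_rel u v \<longleftrightarrow> u \<in> invS \<and> v \<in> invS \<and> u - v \<in> poisson_span"

quotient_type 'n HP0 = "'n::finite cpol" / partial: HP0_rel
  unfolding HP0_rel_def
  by (rule part_equivp_quotient[OF cpoly.vector_space_axioms subspace_invS])
     (simp add: poisson_span_def)

lemmas HP0_closed =
  cpoly.subspace_0[OF subspace_invS] cpoly.subspace_add[OF subspace_invS]
  cpoly.subspace_diff[OF subspace_invS] cpoly.subspace_neg[OF subspace_invS]
  cpoly.subspace_scale[OF subspace_invS]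
  cpoly.span_zero[of "{poisson f g | f g. f \<in> invS \<and> g \<in> invS}", folded poisson_span_def]
  cpoly.span_add[of _ "{poisson f g | f g. f \<in> invS \<and> g \<in> invS}", folded poisson_span_def]
  cpoly.span_diff[of _ "{poisson f g | f g. f \<in> invS \<and> g \<in> invS}", folded poisson_span_def]
  cpoly.span_neg[of _ "{poisson f g | f g. f \<in> invS \<and> g \<in> invS}", folded poisson_span_def]
  cpoly.span_scale[of _ "{poisson f g | f g. f \<in> invS \<and> g \<in> invS}", folded poisson_span_def]

instantiation HP0 :: (finite) ab_group_add
begin

lift_definition zero_HP0 :: "'a HP0" is 0
  by (simp add: HP0_rel_def HP0_closed)

lift_definition plus_HP0 :: "'a HP0 \<Rightarrow> 'a HP0 \<Rightarrow> 'a HP0" is "(+)"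
  unfolding HP0_rel_def by (simp add: HP0_closed add_diff_add)

lift_definition uminus_HP0 :: "'a HP0 \<Rightarrow> 'a HP0" is uminus
  unfolding HP0_rel_def by (simp only: HP0_closed minus_diff_minus)

lift_definition minus_HP0 :: "'a HP0 \<Rightarrow> 'a HP0 \<Rightarrow> 'a HP0" is "(-)"
proof -
  fix a b c d :: "'a cpol"
  assume "HP0_rel a b" "HP0_rel c d"
  moreover have "a - c - (b - d) = (a - b) - (c - d)" by simp
  ultimately show "HP0_rel (a - c) (b - d)"
    by (simp only: HP0_rel_def HP0_closed)
qed

instance
  by standard (transfer; simp add: HP0_rel_def HP0_closed algebra_simps)+

end

lift_definition scaleHP0 :: "complex \<Rightarrow> 'n::finite HP0 \<Rightarrow> 'n HP0" is scaleP
  unfolding HP0_rel_def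
  by (simp add: HP0_closed flip: cpoly.scale_right_diff_distrib)

interpretation HP0: vector_space "scaleHP0 :: complex \<Rightarrow> 'n::finite HP0 \<Rightarrow> 'n HP0"
  by unfold_locales
     (transfer; simp add: HP0_rel_def HP0_closed cpoly.scale_left_distrib
        cpoly.scale_right_distrib)+

definition HH0_rel :: "'n::finite weyl \<Rightarrow> 'n weyl \<Rightarrow> bool"
  where "HH0_rel u v \<longleftrightarrow> u \<in> invA \<and> v \<in> invA \<and> u - v \<in> commutator_span"

quotient_type 'n HH0 = "'n::finite weyl" / partial: HH0_rel
  unfolding HH0_rel_def
  by (rule part_equivp_quotient[OF weyl.vector_space_axioms subspace_invA])
     (simp add: commutator_span_def)

lemmas HH0_closed =
  weyl.subspace_0[OF subspace_invA] weyl.subspace_add[OF subspace_invA]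
  weyl.subspace_diff[OF subspace_invA] weyl.subspace_neg[OF subspace_invA]
  weyl.subspace_scale[OF subspace_invA]
  weyl.span_zero[of "{commutator a b | a b. a \<in> invA \<and> b \<in> invA}", folded commutator_span_def]
  weyl.span_add[of _ "{commutator a b | a b. a \<in> invA \<and> b \<in> invA}", folded commutator_span_def]
  weyl.span_diff[of _ "{commutator a b | a b. a \<in> invA \<and> b \<in> invA}", folded commutator_span_def]
  weyl.span_neg[of _ "{commutator a b | a b. a \<in> invA \<and> b \<in> invA}", folded commutator_span_def]
  weyl.span_scale[of _ "{commutator a b | a b. a \<in> invA \<and> b \<in> invA}", folded commutator_span_def]

instantiation HH0 :: (finite) ab_group_add
begin

lift_definition zero_HH0 :: "'a HH0" is 0
  by (simp add: HH0_rel_def HH0_closed)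

lift_definition plus_HH0 :: "'a HH0 \<Rightarrow> 'a HH0 \<Rightarrow> 'a HH0" is "(+)"
  unfolding HH0_rel_def by (simp add: HH0_closed add_diff_add)

lift_definition uminus_HH0 :: "'a HH0 \<Rightarrow> 'a HH0" is uminus
  unfolding HH0_rel_def by (simp only: HH0_closed minus_diff_minus)

lift_definition minus_HH0 :: "'a HH0 \<Rightarrow> 'a HH0 \<Rightarrow> 'a HH0" is "(-)"
proof -
  fix a b c d :: "'a weyl"
  assume "HH0_rel a b" "HH0_rel c d"
  moreover have "a - c - (b - d) = (a - b) - (c - d)" by simp
  ultimately show "HH0_rel (a - c) (b - d)"
    by (simp only: HH0_rel_def HH0_closed)
qed

instance
  by standard (transfer; simp add: HH0_rel_def HH0_closed algebra_simps)+

end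

lift_definition scaleHH0 :: "complex \<Rightarrow> 'n::finite HH0 \<Rightarrow> 'n HH0" is scaleA
  unfolding HH0_rel_def
  by (simp add: HH0_closed flip: weyl.scale_right_diff_distrib)

interpretation HH0: vector_space "scaleHH0 :: complex \<Rightarrow> 'n::finite HH0 \<Rightarrow> 'n HH0"
  by unfold_locales
     (transfer; simp add: HH0_rel_def HH0_closed weyl.scale_left_distrib
        weyl.scale_right_distrib)+

end

theory Submission
  imports Defs "HOL-Library.FuncSet"
begin

text \<open>
  The torus weight \<open>i \<mapsto> a i - b i\<close> of a monomial \<open>x^a y^b\<close> is constant modulo 3 on invariants.
  Bracketing with the invariants \<open>z i = x i y i\<close> kills all monomials of nonzero weight, so both
  quotients are quotients of the polynomials in the \<open>z i\<close>.

  For the Poisson bracket, brackets with \<open>x i ^ 3\<close> kill every monomial divisible by some \<open>z i ^ 2\<close>;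
  the remaining relations come from weights all equal to 1 modulo 3 and are
  \<open>z 1 \<cdots> z n = 0\<close> and \<open>\<Sum>i. \<Prod>j\<noteq>i. z j = 0\<close>, which leaves dimension \<open>2^n - 2\<close>.

  For the Weyl algebra, normal ordering identifies \<open>A\<close> with \<open>S\<close> as a vector space with \<open>G\<close>-action.
  For \<open>k \<in> G\<close> without zero entry, \<open>x^a y^b \<mapsto> [a = b] \<Prod>i. a i! t i ^ a i\<close> with
  \<open>t i = 1 / (\<zeta>^(k i) - 1)\<close> is a trace twisted by \<open>k\<close>, hence a trace on \<open>A^G\<close>.
  Commutators with \<open>p i ^ 3\<close> give \<open>3 z i ^ 2 + 6 z i + 2 = 0\<close>, whose roots are the two values of
  \<open>t i\<close>; the products of the linear factors of these quadratics, indexed by \<open>k \<in> {1, 2}^n\<close>,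
  therefore span the quotient, and the commutators with \<open>p 1 \<cdots> p n\<close> kill those with
  \<open>k \<notin> G\<close>.  The others are dual to the twisted traces.
\<close>

section \<open>Dimension of a quotient from a spanning family and dual functionals\<close>

text \<open>The functionals kill \<open>W\<close> and are diagonal on the family \<open>e\<close>
  with nonzero diagonal entries, so applying \<open>lam b\<close> to a linear relation isolates the
  coefficient at \<open>b\<close>; \<open>gen\<close> supplies spanning. Linearity of
  \<open>\<pi>\<close> is demanded on \<open>V\<close> alone, because the abstraction maps of the
  partial quotients are controlled only on the invariants.\<close>

lemma dim_quotient:
  fixes scl :: "'f::field \<Rightarrow> 'v::ab_group_add \<Rightarrow> 'v" and scl' :: "'f \<Rightarrow> 'q::ab_group_add \<Rightarrow> 'q"
    and e :: "'b \<Rightarrow> 'v" and lam :: "'b \<Rightarrow> 'v \<Rightarrow> 'f"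
  assumes "vector_space scl" and "vector_space scl'"
    and V: "module.subspace scl V"
    and pi_add: "\<And>u v. u \<in> V \<Longrightarrow> v \<in> V \<Longrightarrow> \<pi> (u + v) = \<pi> u + \<pi> v"
    and pi_scale: "\<And>c v. v \<in> V \<Longrightarrow> \<pi> (scl c v) = scl' c (\<pi> v)"
    and pi_surj: "\<And>x. \<exists>v\<in>V. \<pi> v = x"
    and pi_ker: "\<And>v. v \<in> V \<Longrightarrow> \<pi> v = 0 \<longleftrightarrow> v \<in> W"
    and fin: "finite B"
    and eV: "\<And>b. b \<in> B \<Longrightarrow> e b \<in> V"
    and l_add: "\<And>b u v. lam b (u + v) = lam b u + lam b v"
    and l_scale: "\<And>b c v. lam b (scl c v) = c * lam b v"
    and l_W: "\<And>b v. b \<in> B \<Longrightarrow> v \<in> W \<Longrightarrow> lam b v = 0"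
    and l_e: "\<And>b c. b \<in> B \<Longrightarrow> c \<in> B \<Longrightarrow> lam b (e c) \<noteq> 0 \<longleftrightarrow> b = c"
    and WV: "W \<subseteq> V"
    and gen: "V \<subseteq> module.span scl (W \<union> e ` B)"
  shows "vector_space.dim scl' (UNIV :: 'q set) = card B"
proof -
  interpret v: vector_space scl by fact
  interpret q: vector_space scl' by fact
  have sumV: "(\<Sum>b\<in>A. scl (c b) (e b)) \<in> V" if "A \<subseteq> B" for c A
    using that eV by (intro v.subspace_sum[OF V] v.subspace_scale[OF V]) auto
  have pi_0: "\<pi> 0 = 0"
    using pi_add[of 0 0] v.subspace_0[OF V] by simp
  have pi_sum: "\<pi> (\<Sum>b\<in>A. scl (c b) (e b)) = (\<Sum>b\<in>A. scl' (c b) (\<pi> (e b)))" if "A \<subseteq> B" for c A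
    using finite_subset[OF that fin] that
  proof (induction A rule: finite_induct)
    case (insert a A)
    then show ?case
      using eV sumV[of A c] by (simp add: pi_add pi_scale v.subspace_scale[OF V])
  qed (simp add: pi_0)
  have l_0: "lam b 0 = 0" for b
    using l_add[of b 0 0] by (metis add.right_neutral add_left_cancel)
  have l_sum: "lam b (\<Sum>d\<in>A. scl (c d) (e d)) = (\<Sum>d\<in>A. c d * lam b (e d))" if "finite A" for b c A
    using that by (induction A rule: finite_induct) (simp_all add: l_0 l_add l_scale)
  have zero: "c b = 0" if "(\<Sum>b\<in>B. scl' (c b) (\<pi> (e b))) = 0" "b \<in> B" for c b
  proof -
    have "(\<Sum>b\<in>B. scl (c b) (e b)) \<in> W"
      using that(1) pi_ker sumV pi_sum by (metis order_refl)
    then have "lam b (\<Sum>b\<in>B. scl (c b) (e b)) = 0"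
      using l_W that(2) by blast
    moreover have "(\<Sum>d\<in>B. c d * lam b (e d)) = (\<Sum>d\<in>B. if d = b then c b * lam b (e b) else 0)"
      using l_e that(2) by (intro sum.cong) auto
    ultimately have "c b * lam b (e b) = 0"
      using that(2) fin by (simp add: l_sum)
    then show ?thesis
      using l_e that(2) by auto
  qed
  \<comment> \<open>\<open>dim_eq_card\<close> counts the image set, so distinct indices must have
    distinct images. A collision would be a relation with coefficients 1 and -1, which
    \<open>zero\<close> excludes.\<close>
  have inj: "inj_on (\<lambda>b. \<pi> (e b)) B"
  proof (rule inj_onI)
    fix a b
    assume ab: "a \<in> B" "b \<in> B" "\<pi> (e a) = \<pi> (e b)"
    show "a = b"
    proof (rule ccontr)
      assume "a \<noteq> b"
      let ?c = "\<lambda>d. if d = a then 1 else if d = b then - 1 else (0::'f)"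
      have "(\<Sum>d\<in>B. scl' (?c d) (\<pi> (e d))) =
          (\<Sum>d\<in>B. (if d = a then \<pi> (e a) else 0) + (if d = b then - \<pi> (e b) else 0))"
        using \<open>a \<noteq> b\<close> by (intro sum.cong) auto
      also have "\<dots> = 0"
        using ab fin by (simp add: sum.distrib)
      finally show False
        using zero[of ?c a] ab by auto
    qed
  qed
  have indep: "q.independent ((\<lambda>b. \<pi> (e b)) ` B)"
  proof (rule q.independent_if_scalars_zero)
    fix g x
    assume "(\<Sum>x\<in>(\<lambda>b. \<pi> (e b)) ` B. scl' (g x) x) = 0" and x: "x \<in> (\<lambda>b. \<pi> (e b)) ` B"
    then have "(\<Sum>b\<in>B. scl' (g (\<pi> (e b))) (\<pi> (e b))) = 0"
      by (simp add: sum.reindex[OF inj])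
    with zero[of "\<lambda>b. g (\<pi> (e b))"] x show "g x = 0" by auto
  qed (use fin in simp)
  \<comment> \<open>Membership in \<open>V\<close> is carried through the induction since
    \<open>\<pi>\<close> is additive only there.\<close>
  have "v \<in> V \<and> \<pi> v \<in> q.span ((\<lambda>b. \<pi> (e b)) ` B)" if "v \<in> v.span (W \<union> e ` B)" for v
    using that
  proof (induction rule: v.span_induct_alt)
    case base
    then show ?case by (simp add: v.subspace_0[OF V] pi_0 q.span_zero)
  next
    case (step c x y)
    have "x \<in> V \<and> \<pi> x \<in> q.span ((\<lambda>b. \<pi> (e b)) ` B)"
    proof
      show "x \<in> V" using eV WV step(1) by blast
      show "\<pi> x \<in> q.span ((\<lambda>b. \<pi> (e b)) ` B)"
      proof (cases "x \<in> W")
        case True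
        then have "\<pi> x = 0" using WV pi_ker by blast
        then show ?thesis by (simp add: q.span_zero)
      next
        case False
        then show ?thesis using step(1) by (intro q.span_base) blast
      qed
    qed
    with step show ?case
      by (simp add: pi_add pi_scale v.subspace_add[OF V] v.subspace_scale[OF V] q.span_add q.span_scale)
  qed
  then have "x \<in> q.span ((\<lambda>b. \<pi> (e b)) ` B)" for x
    using pi_surj[of x] gen by (metis subsetD)
  then have "q.span ((\<lambda>b. \<pi> (e b)) ` B) = q.span UNIV" by (auto simp: q.span_UNIV)
  from q.dim_eq_card[OF this indep] show ?thesis
    by (simp add: card_image[OF inj])
qed

lemma dim_HP0:
  fixes e :: "'b \<Rightarrow> 'n::finite cpol"
  assumes "finite B"
    and "\<And>b. b \<in> B \<Longrightarrow> e b \<in> invS"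
    and "\<And>b u v. lam b (u + v) = lam b u + lam b v"
    and "\<And>b c v. lam b (scaleP c v) = c * lam b v"
    and "\<And>b v. b \<in> B \<Longrightarrow> v \<in> poisson_span \<Longrightarrow> lam b v = 0"
    and "\<And>b c. b \<in> B \<Longrightarrow> c \<in> B \<Longrightarrow> lam b (e c) \<noteq> 0 \<longleftrightarrow> b = c"
    and "poisson_span \<subseteq> (invS :: 'n cpol set)"
    and "invS \<subseteq> cpoly.span (poisson_span \<union> e ` B)"
  shows "HP0.dim (UNIV :: 'n HP0 set) = card B"
proof (rule dim_quotient[OF cpoly.vector_space_axioms HP0.vector_space_axioms subspace_invS, where \<pi> = abs_HP0 and lam = lam and e = e])
  note Q = Quotient3_HP0
  have rel: "HP0_rel v v \<longleftrightarrow> v \<in> invS" for v :: "'n cpol"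
    by (simp add: HP0_rel_def HP0_closed)
  show "abs_HP0 (u + v) = abs_HP0 u + abs_HP0 v" if "u \<in> invS" "v \<in> invS" for u v :: "'n cpol"
    using that by (simp add: plus_HP0.abs_eq eq_onp_same_args rel)
  show "abs_HP0 (scaleP c v) = scaleHP0 c (abs_HP0 v)" if "v \<in> invS" for c and v :: "'n cpol"
    using that by (simp add: scaleHP0.abs_eq eq_onp_same_args rel)
  show "\<exists>v\<in>invS. abs_HP0 v = x" for x :: "'n HP0"
    using Quotient3_abs_rep[OF Q] Quotient3_rep_reflp[OF Q] rel by metis
  show "abs_HP0 v = 0 \<longleftrightarrow> v \<in> poisson_span" if "v \<in> invS" for v :: "'n cpol"
    using Quotient3_rel[OF Q, of v 0] that
    by (simp add: rel zero_HP0_def) (simp add: HP0_rel_def HP0_closed)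
qed (fact assms)+

lemma dim_HH0:
  fixes e :: "'b \<Rightarrow> 'n::finite weyl"
  assumes "finite B"
    and "\<And>b. b \<in> B \<Longrightarrow> e b \<in> invA"
    and "\<And>b u v. lam b (u + v) = lam b u + lam b v"
    and "\<And>b c v. lam b (scaleA c v) = c * lam b v"
    and "\<And>b v. b \<in> B \<Longrightarrow> v \<in> commutator_span \<Longrightarrow> lam b v = 0"
    and "\<And>b c. b \<in> B \<Longrightarrow> c \<in> B \<Longrightarrow> lam b (e c) \<noteq> 0 \<longleftrightarrow> b = c"
    and "commutator_span \<subseteq> (invA :: 'n weyl set)"
    and "invA \<subseteq> weyl.span (commutator_span \<union> e ` B)"
  shows "HH0.dim (UNIV :: 'n HH0 set) = card B"
proof (rule dim_quotient[OF weyl.vector_space_axioms HH0.vector_space_axioms subspace_invA, where \<pi> = abs_HH0 and lam = lam and e = e])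
  note Q = Quotient3_HH0
  have rel: "HH0_rel v v \<longleftrightarrow> v \<in> invA" for v :: "'n weyl"
    by (simp add: HH0_rel_def HH0_closed)
  show "abs_HH0 (u + v) = abs_HH0 u + abs_HH0 v" if "u \<in> invA" "v \<in> invA" for u v :: "'n weyl"
    using that by (simp add: plus_HH0.abs_eq eq_onp_same_args rel)
  show "abs_HH0 (scaleA c v) = scaleHH0 c (abs_HH0 v)" if "v \<in> invA" for c and v :: "'n weyl"
    using that by (simp add: scaleHH0.abs_eq eq_onp_same_args rel)
  show "\<exists>v\<in>invA. abs_HH0 v = x" for x :: "'n HH0"
    using Quotient3_abs_rep[OF Q] Quotient3_rep_reflp[OF Q] rel by metis
  show "abs_HH0 v = 0 \<longleftrightarrow> v \<in> commutator_span" if "v \<in> invA" for v :: "'n weyl"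
    using Quotient3_rel[OF Q, of v 0] that
    by (simp add: rel zero_HH0_def) (simp add: HH0_rel_def HH0_closed)
qed (fact assms)+


subsection \<open>Characters of the residues modulo 3\<close>

text \<open>The faithful character of the cyclic group of order 3 with value \<open>zeta\<close> at
  1.\<close>

definition chi :: "3 \<Rightarrow> complex"
  where "chi k = zeta powi Rep_bit1 k"

lemma of_int_surj3: "\<exists>z. (k::3) = of_int z"
  by (cases k rule: bit1_cases) auto

lemma chi_of_int [simp]: "chi (of_int z) = zeta powi z"
  by (simp add: chi_def zeta_powi_representative)

lemma chi_0 [simp]: "chi 0 = 1"
  using chi_of_int[of 0] by simp

lemma chi_nonzero [simp]: "chi k \<noteq> 0"
  by (simp add: chi_def)

lemma chi_add: "chi (a + b) = chi a * chi b"
proof -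
  obtain u v where "a = of_int u" "b = of_int v" using of_int_surj3 by metis
  then show ?thesis
    using chi_of_int[of "u + v"] by (simp add: power_int_add)
qed

lemma chi_sum: "chi (\<Sum>i\<in>A. f i) = (\<Prod>i\<in>A. chi (f i))"
  by (induction A rule: infinite_finite_induct) (simp_all add: chi_add)

lemma chi_mult_of_int: "chi (k * of_int z) = chi k powi z"
proof -
  obtain u where "k = of_int u" using of_int_surj3 by metis
  then show ?thesis
    using chi_of_int[of "u * z"] by (simp add: power_int_mult)
qed

lemma zeta_neq_1: "zeta \<noteq> 1"
proof -
  have "zeta = cis (2 * pi / 3)"
    by (simp add: zeta_def cis_conv_exp mult_ac)
  then have "Im zeta = sin (2 * pi / 3)" by (metis cis.sel(2))
  moreover have "sin (2 * pi / 3) > 0"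
    by (rule sin_gt_zero) auto
  ultimately show ?thesis by auto
qed

lemma UNIV_3: "(UNIV :: 3 set) = {0, 1, 2}"
proof -
  have "card {0, 1, 2 :: 3} = card (UNIV :: 3 set)" by simp
  then show ?thesis
    by (metis card_subset_eq finite_class.finite_UNIV subset_UNIV)
qed

lemma chi_1: "chi 1 = zeta" and chi_2: "chi 2 = zeta\<^sup>2"
  using chi_of_int[of 1] chi_of_int[of 2] by simp_all

lemma chi_eq_1_iff [simp]: "chi k = 1 \<longleftrightarrow> k = 0"
proof -
  have "zeta\<^sup>2 \<noteq> 1"
    using zeta_cubed zeta_neq_1 by (auto simp: power3_eq_cube power2_eq_square)
  moreover have "k \<in> {0, 1, 2}" using UNIV_3 by blast
  ultimately show ?thesis
    by (auto simp: chi_1 chi_2 zeta_neq_1)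
qed

lemma chi_cubed: "chi k ^ 3 = 1"
proof -
  obtain u where u: "k = of_int u" using of_int_surj3 by metis
  have "chi k ^ 3 = (zeta powi u) powi 3" by (simp add: u)
  also have "\<dots> = (zeta powi 3) powi u"
    by (simp only: flip: power_int_mult) (simp add: mult.commute)
  finally show ?thesis by (simp add: zeta_cubed)
qed

lemma chi_primitive: "(chi k)\<^sup>2 + chi k + 1 = 0" if "k \<noteq> 0"
proof -
  have "(chi k - 1) * ((chi k)\<^sup>2 + chi k + 1) = chi k ^ 3 - 1"
    by (simp add: algebra_simps power2_eq_square power3_eq_cube)
  then show ?thesis using that by (simp add: chi_cubed)
qed

text \<open>Faithfulness of \<open>chi\<close> converts equations between residues into divisibility
  of integers, where bounds on exponents can be exploited.\<close>

lemma of_int_3_eq_0_iff: "(of_int z :: 3) = 0 \<longleftrightarrow> 3 dvd z"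
proof -
  have "zeta powi z = zeta powi (z mod 3)"
    using zeta_powi_representative[of z] zeta_powi_representative[of "z mod 3"]
    by (simp add: bit1.of_int_eq)
  moreover have "z mod 3 = 0 \<or> z mod 3 = 1 \<or> z mod 3 = 2" by linarith
  moreover have "zeta\<^sup>2 \<noteq> 1"
    using zeta_cubed zeta_neq_1 by (auto simp: power3_eq_cube power2_eq_square)
  ultimately have "zeta powi z = 1 \<longleftrightarrow> 3 dvd z"
    by (auto simp: zeta_neq_1 dvd_eq_mod_eq_0)
  then show ?thesis
    using chi_eq_1_iff[of "of_int z"] by simp
qed


subsection \<open>Polynomials\<close>

abbreviation mon :: "('n pvar \<Rightarrow>\<^sub>0 nat) \<Rightarrow> 'n cpol"
  where "mon m \<equiv> Poly_Mapping.single m 1"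

lemma prod_pvar: "(\<Prod>v\<in>(UNIV :: 'n::finite pvar set). g v) = (\<Prod>i\<in>UNIV. g (X i) * g (Y i))"
  for g :: "_ \<Rightarrow> 'a::comm_monoid_mult"
proof -
  have "(UNIV :: 'n pvar set) = range X \<union> range Y"
    by (metis UNIV_eq_I UnCI pvar.exhaust rangeI)
  then have "prod g UNIV = prod g (range X \<union> range Y)"
    by (rule arg_cong)
  also have "\<dots> = prod g (range X) * prod g (range Y)"
    by (rule prod.union_disjoint) auto
  finally have "prod g UNIV = prod g (range X) * prod g (range Y)" .
  then show ?thesis
    by (simp add: prod.reindex inj_def prod.distrib)
qed

lemma scaleP_power: "scaleP c f ^ n = scaleP (c ^ n) (f ^ n)"
  by (induction n) (simp_all add: scaleP_mult_left scaleP_mult_right)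

lemma scaleP_prod: "(\<Prod>i\<in>A. scaleP (c i) (f i)) = scaleP (\<Prod>i\<in>A. c i) (\<Prod>i\<in>A. f i)"
  for f :: "_ \<Rightarrow> ('k::comm_monoid_add \<Rightarrow>\<^sub>0 complex)"
  by (induction A rule: infinite_finite_induct) (simp_all add: scaleP_mult_left scaleP_mult_right mult_ac)

lemma pv_power: "pv v ^ k = mon (Poly_Mapping.single v k)"
  by (induction k) (simp_all add: pv_def mult_single flip: single_add)

lemma prod_single: "(\<Prod>i\<in>A. mon (f i)) = mon (\<Sum>i\<in>A. f i)"
  by (induction A rule: infinite_finite_induct) (simp_all add: mult_single)

lemma exponent_eq_sum: "m = (\<Sum>v\<in>UNIV. Poly_Mapping.single v (Poly_Mapping.lookup m v))"
  for m :: "'n::finite pvar \<Rightarrow>\<^sub>0 nat"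
  by (rule poly_mapping_eqI) (simp add: lookup_sum lookup_single when_def)

lemma mon_eq_prod: "mon m = (\<Prod>i\<in>UNIV. pv (X i) ^ Poly_Mapping.lookup m (X i) * pv (Y i) ^ Poly_Mapping.lookup m (Y i))"
  for m :: "'n::finite pvar \<Rightarrow>\<^sub>0 nat"
proof -
  have "mon m = (\<Prod>v\<in>UNIV. pv v ^ Poly_Mapping.lookup m v)"
    by (subst exponent_eq_sum) (simp only: pv_power prod_single)
  then show ?thesis by (simp only: prod_pvar)
qed

lemma scaleP_mon: "scaleP c (Poly_Mapping.single m 1) = Poly_Mapping.single m c"
  by (simp add: scaleP_def mult_single)

lemma cpol_eq_sum: "f = (\<Sum>m\<in>Poly_Mapping.keys f. scaleP (Poly_Mapping.lookup f m) (Poly_Mapping.single m 1))"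
  using sum_single_keys[of f] by (simp add: scaleP_mon)

lemma cpol_linear_induct [case_names add scale mon]:
  fixes f :: "'k::monoid_add \<Rightarrow>\<^sub>0 complex"
  assumes "\<And>f g. R f \<Longrightarrow> R g \<Longrightarrow> R (f + g)" "\<And>c f. R f \<Longrightarrow> R (scaleP c f)"
    and "\<And>m. R (Poly_Mapping.single m 1)"
  shows "R f"
proof -
  have "R 0" using assms(2)[OF assms(3), of 0] by simp
  then have "R (\<Sum>m\<in>A. scaleP (c m) (Poly_Mapping.single m 1))" for A c
    by (induction A rule: infinite_finite_induct) (auto intro: assms)
  then show ?thesis by (subst cpol_eq_sum)
qed

text \<open>Monomials arise from 1 by multiplying with variables. This form suits operators whose
  interaction with a single variable is known.\<close>

lemma cpol_induct [case_names add scale one var]: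
  fixes f :: "'n::finite cpol"
  assumes "\<And>f g. R f \<Longrightarrow> R g \<Longrightarrow> R (f + g)" "\<And>c f. R f \<Longrightarrow> R (scaleP c f)"
    and "R 1" and "\<And>v f. R f \<Longrightarrow> R (pv v * f)"
  shows "R f"
proof (induction f rule: cpol_linear_induct)
  case (mon m)
  have pow: "R (pv v ^ k * f)" if "R f" for v k f
    by (induction k) (simp_all add: that mult.assoc assms(4))
  have "R (\<Prod>v\<in>A. pv v ^ Poly_Mapping.lookup m v)" for A :: "'n pvar set"
    by (induction A rule: infinite_finite_induct) (simp_all add: pow assms(3))
  from this[of UNIV] show ?case by (simp add: mon_eq_prod prod_pvar)
qed (use assms in auto)

subsection \<open>Derivatives\<close>

lemma pdiff_add: "pdiff v (f + g) = pdiff v f + pdiff v g"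
  and pdiff_scale: "pdiff v (scaleP c f) = scaleP c (pdiff v f)"
  and pdiff_0 [simp]: "pdiff v 0 = 0"
  by (simp_all add: pdiff_def lin_ext_add lin_ext_scale)

lemma pdiff_1 [simp]: "pdiff v 1 = 0"
  using pdiff_mult[of v 1 1] by simp

lemma pdiff_mon: "pdiff v (mon m) =
    Poly_Mapping.single (m - Poly_Mapping.single v 1) (of_nat (Poly_Mapping.lookup m v))"
  by (simp add: pdiff_def)

lemma pdiff_of_nat [simp]: "pdiff v (of_nat n) = 0"
  by (induction n) (simp_all add: pdiff_add)

lemma pdiff_numeral [simp]: "pdiff v (numeral n) = 0"
  using pdiff_of_nat[of v "numeral n"] by simp

lemma pdiff_power: "pdiff v (f ^ n) = of_nat n * f ^ (n - 1) * pdiff v f"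
proof (induction n)
  case (Suc n)
  then show ?case
    by (cases n) (simp_all add: pdiff_mult algebra_simps)
qed simp

lemma pdiff_prod_0: "(\<And>i. i \<in> A \<Longrightarrow> pdiff v (f i) = 0) \<Longrightarrow> pdiff v (\<Prod>i\<in>A. f i) = 0"
  by (induction A rule: infinite_finite_induct) (simp_all add: pdiff_mult)

text \<open>Monomials diagonalise the Euler operator. The truncated subtraction in
  \<open>pdiff\<close> is undone when \<open>v\<close> occurs in \<open>m\<close>; otherwise both
  sides vanish.\<close>

lemma euler: "pv v * pdiff v (mon m) = scaleP (of_nat (Poly_Mapping.lookup m v)) (mon m)"
proof (cases "Poly_Mapping.lookup m v = 0")
  case False
  then have "Poly_Mapping.single v 1 + (m - Poly_Mapping.single v 1) = m"
    by (intro poly_mapping_eqI) (auto simp: lookup_add lookup_minus lookup_single when_def)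
  then show ?thesis by (simp add: pdiff_mon pv_def mult_single scaleP_mon)
qed (simp add: pdiff_mon)

subsection \<open>Invariant polynomials\<close>

definition weight :: "('n pvar \<Rightarrow>\<^sub>0 nat) \<Rightarrow> 'n \<Rightarrow> int"
  where "weight m i = int (Poly_Mapping.lookup m (X i)) - int (Poly_Mapping.lookup m (Y i))"

lemma actS_add: "actS k (f + g) = actS k f + actS k g"
  and actS_scale: "actS k (scaleP c f) = scaleP c (actS k f)"
  by (simp_all add: actS_def psubst_def lin_ext_add lin_ext_scale)

lemma actS_mult: "actS k (f * g) = actS k f * actS k g"
  by (simp add: actS_def psubst_mult)

lemma actS_pv:
  "actS k (pv (X i)) = scaleP (chi (k i)) (pv (X i))"
  "actS k (pv (Y i)) = scaleP (inverse (chi (k i))) (pv (Y i))"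
  by (simp_all add: actS_def chi_def power_int_minus)

lemma actS_mon: "actS k (mon m) = scaleP (chi (\<Sum>i\<in>UNIV. k i * of_int (weight m i))) (mon m)"
  for m :: "'n::finite pvar \<Rightarrow>\<^sub>0 nat"
proof -
  have *: "chi x powi weight m i = chi x ^ Poly_Mapping.lookup m (X i) * inverse (chi x) ^ Poly_Mapping.lookup m (Y i)" for x i
    by (simp add: weight_def power_int_diff power_inverse divide_inverse)
  have "actS k (mon m) = (\<Prod>i\<in>UNIV. actS k (pv (X i)) ^ Poly_Mapping.lookup m (X i) * actS k (pv (Y i)) ^ Poly_Mapping.lookup m (Y i))"
  proof -
    have "psubst \<sigma> (mon m) = (\<Prod>i\<in>UNIV. \<sigma> (X i) ^ Poly_Mapping.lookup m (X i) * \<sigma> (Y i) ^ Poly_Mapping.lookup m (Y i))" for \<sigma> :: "'n pvar \<Rightarrow> 'n cpol"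
      by (simp add: psubst_def prod_pvar)
    then show ?thesis by (simp add: actS_def)
  qed
  also have "\<dots> = (\<Prod>i\<in>UNIV. scaleP (chi (k i) powi weight m i) (pv (X i) ^ Poly_Mapping.lookup m (X i) * pv (Y i) ^ Poly_Mapping.lookup m (Y i)))"
    by (simp add: actS_pv scaleP_power scaleP_mult_left scaleP_mult_right * mult.commute)
  also have "\<dots> = scaleP (\<Prod>i\<in>UNIV. chi (k i) powi weight m i) (mon m)"
    by (simp add: scaleP_prod mon_eq_prod)
  finally show ?thesis by (simp add: chi_sum chi_mult_of_int)
qed

lemma lookup_actS: "Poly_Mapping.lookup (actS k f) m = chi (\<Sum>i\<in>UNIV. k i * of_int (weight m i)) * Poly_Mapping.lookup f m"
proof (induction f rule: cpol_linear_induct)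
  case (mon n)
  then show ?case by (simp add: actS_mon lookup_single when_def)
qed (simp_all add: actS_add actS_scale lookup_add algebra_simps)

text \<open>The group acts on a monomial by the character
  \<open>k \<mapsto> chi (\<Sum>i. k i * weight m i)\<close>. Testing it on the group element with
  entries 1 at \<open>i\<close> and -1 at \<open>j\<close> compares two weights; conversely a common
  weight factors out of a sum that vanishes on the group.\<close>

lemma mon_in_invS: "mon m \<in> invS \<longleftrightarrow> (\<forall>i j. (of_int (weight m i) :: 3) = of_int (weight m j))"
  for m :: "'n::finite pvar \<Rightarrow>\<^sub>0 nat"
proof -
  have "mon m \<in> invS \<longleftrightarrow> (\<forall>k\<in>grp. (\<Sum>i\<in>UNIV. k i * of_int (weight m i)) = 0)"
  proof -
    have "scaleP c (mon m) = mon m \<longleftrightarrow> c = 1" for c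
      by (metis cpoly.scale_one lookup_scaleP lookup_single_eq mult.right_neutral)
    then show ?thesis
      by (simp add: invS_def actS_mon)
  qed
  also have "\<dots> \<longleftrightarrow> (\<forall>i j. (of_int (weight m i) :: 3) = of_int (weight m j))"
  proof (intro iffI allI ballI)
    fix i j
    assume *: "\<forall>k\<in>grp. (\<Sum>i\<in>UNIV. k i * of_int (weight m i)) = 0"
    let ?k = "\<lambda>l::'n. (if l = i then 1 else 0) - (if l = j then 1 else (0::3))"
    have "?k \<in> grp" by (simp add: grp_def sum_subtractf)
    from bspec[OF * this] have "(\<Sum>l\<in>UNIV. ?k l * of_int (weight m l)) = 0" .
    also have "(\<lambda>l. ?k l * of_int (weight m l)) =
      (\<lambda>l. (if l = i then of_int (weight m i) else 0) - (if l = j then of_int (weight m j) else 0))"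
      by auto
    finally show "(of_int (weight m i) :: 3) = of_int (weight m j)"
      by (simp add: sum_subtractf)
  next
    fix k :: "'n \<Rightarrow> 3"
    assume *: "\<forall>i j. (of_int (weight m i) :: 3) = of_int (weight m j)" and k: "k \<in> grp"
    \<comment> \<open>All residues agree, so the weight at the arbitrary index
      \<open>undefined\<close> can replace each of them.\<close>
    have "(\<Sum>i\<in>UNIV. k i * of_int (weight m i)) = (\<Sum>i\<in>UNIV. k i * of_int (weight m undefined))"
      by (intro sum.cong refl arg_cong2[where f = "(*)"] *[rule_format])
    also have "\<dots> = 0" using k by (simp add: grp_def flip: sum_distrib_right)
    finally show "(\<Sum>i\<in>UNIV. k i * of_int (weight m i)) = 0" .
  qed
  finally show ?thesis .
qed

text \<open>The action is diagonal on monomials, so a nonzero coefficient of an invariant forces the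
  eigenvalue of its monomial to be 1.\<close>

lemma invS_keys: "mon m \<in> invS" if "f \<in> invS" "m \<in> Poly_Mapping.keys f"
  for f :: "'n::finite cpol"
proof -
  have "chi (\<Sum>i\<in>UNIV. k i * of_int (weight m i)) = 1" if "k \<in> grp" for k :: "'n \<Rightarrow> 3"
    using lookup_actS[of k f m] that \<open>f \<in> invS\<close> \<open>m \<in> _\<close> by (auto simp: invS_def in_keys_iff)
  then show ?thesis by (simp add: invS_def actS_mon)
qed

lemma invS_induct [consumes 1, case_names add scale mon]:
  fixes f :: "'n::finite cpol"
  assumes "f \<in> invS"
    and "\<And>f g. R f \<Longrightarrow> R g \<Longrightarrow> R (f + g)" "\<And>c f. R f \<Longrightarrow> R (scaleP c f)"
    and "\<And>m. mon m \<in> invS \<Longrightarrow> R (mon m)"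
  shows "R f"
proof -
  have "mon (0 :: 'n pvar \<Rightarrow>\<^sub>0 nat) \<in> invS"
    unfolding mon_in_invS by (simp add: weight_def)
  then have "R 0" using assms(3)[OF assms(4), of 0 0] by simp
  then have "R (\<Sum>m\<in>A. scaleP (c m) (mon m))" if "\<And>m. m \<in> A \<Longrightarrow> mon m \<in> invS" for A c
    using that by (induction A rule: infinite_finite_induct) (auto intro: assms)
  from this[OF invS_keys[OF assms(1)]] show ?thesis
    by (subst cpol_eq_sum)
qed

lemma invS_if_keys:
  fixes f :: "'n::finite cpol"
  assumes "\<And>m. Poly_Mapping.lookup f m \<noteq> 0 \<Longrightarrow> mon m \<in> invS"
  shows "f \<in> invS"
  by (subst cpol_eq_sum)
    (intro cpoly.subspace_sum[OF subspace_invS] cpoly.subspace_scale[OF subspace_invS] assms, simp add: in_keys_iff)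

lemma invS_1 [simp]: "1 \<in> invS"
  using mon_in_invS[of 0] by (simp add: weight_def)

lemma invS_mult: "f \<in> invS \<Longrightarrow> g \<in> invS \<Longrightarrow> f * g \<in> invS"
  by (simp add: invS_def actS_mult)

lemma invS_prod: "(\<And>i. i \<in> A \<Longrightarrow> f i \<in> invS) \<Longrightarrow> (\<Prod>i\<in>A. f i) \<in> invS"
  by (induction A rule: infinite_finite_induct) (auto intro: invS_mult)

lemma invS_power: "f \<in> invS \<Longrightarrow> f ^ n \<in> invS"
  by (induction n) (auto intro: invS_mult)

abbreviation zz :: "'n \<Rightarrow> 'n cpol" where "zz i \<equiv> pv (X i) * pv (Y i)"

lemma invS_zz [simp]: "zz i \<in> invS"
  by (simp add: invS_def actS_mult actS_pv scaleP_mult_left scaleP_mult_right)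

lemma invS_cubes [simp]: "pv (X i) ^ 3 \<in> invS" "pv (Y i) ^ 3 \<in> invS"
  for i :: "'n::finite"
proof -
  have "actS k (f ^ 3) = actS k f ^ 3" for k and f :: "'n cpol"
    by (simp add: power3_eq_cube actS_mult)
  then show "pv (X i) ^ 3 \<in> invS" "pv (Y i) ^ 3 \<in> invS"
    by (simp_all add: invS_def actS_pv scaleP_power chi_cubed power_inverse)
qed

text \<open>All weights are 1, respectively -1, hence constant.\<close>

lemma invS_prods [simp]: "(\<Prod>i\<in>UNIV. pv (X i)) \<in> invS" "(\<Prod>i\<in>UNIV. pv (Y i)) \<in> invS"
proof -
  have p: "(\<Prod>i\<in>UNIV. pv (g i)) = mon (\<Sum>i\<in>UNIV. Poly_Mapping.single (g i) 1)" for g :: "'n::finite \<Rightarrow> 'n pvar"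
    by (simp add: prod_single pv_def)
  show "(\<Prod>i\<in>UNIV. pv (X i)) \<in> invS" "(\<Prod>i\<in>UNIV. pv (Y i)) \<in> invS"
    unfolding p mon_in_invS by (simp_all add: weight_def lookup_sum lookup_single when_def)
qed


subsection \<open>Monomials of weight zero\<close>

definition zmon :: "('n::finite \<Rightarrow> nat) \<Rightarrow> 'n cpol"
  where "zmon s = (\<Prod>i\<in>UNIV. zz i ^ s i)"

lemma of_nat_mult_scaleP: "of_nat n * f = scaleP (of_nat n) f"
  by (induction n) (simp_all add: algebra_simps cpoly.scale_left_distrib)

lemma numeral_mult_scaleP: "numeral n * f = scaleP (numeral n) f"
  using of_nat_mult_scaleP[of "numeral n"] by simp

lemma zmon_split: "zmon s = zz i ^ s i * (\<Prod>j\<in>UNIV - {i}. zz j ^ s j)"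
  by (simp add: zmon_def prod.remove)

lemma pdiff_zz_other: "i \<noteq> j \<Longrightarrow> pdiff (X i) (zz j) = 0" "i \<noteq> j \<Longrightarrow> pdiff (Y i) (zz j) = 0"
  by (simp_all add: pdiff_mult pdiff_pv)

lemma pdiff_zmon_rest:
  "pdiff (X i) (\<Prod>j\<in>UNIV - {i}. zz j ^ s j) = 0" "pdiff (Y i) (\<Prod>j\<in>UNIV - {i}. zz j ^ s j) = 0"
  by (rule pdiff_prod_0, simp add: pdiff_power pdiff_zz_other)+

lemma invS_zmon [simp]: "zmon s \<in> invS"
  unfolding zmon_def by (intro invS_prod invS_power invS_zz)

lemma invS_zmon_rest [simp]: "(\<Prod>j\<in>A. zz j ^ s j) \<in> invS"
  by (intro invS_prod invS_power invS_zz)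

lemma mon_weight_0:
  assumes "\<And>i. weight m i = 0"
  shows "mon m = zmon (\<lambda>i. Poly_Mapping.lookup m (X i))"
proof -
  have "Poly_Mapping.lookup m (Y i) = Poly_Mapping.lookup m (X i)" for i
    using assms[of i] by (simp add: weight_def)
  then show ?thesis
    by (simp add: mon_eq_prod zmon_def power_mult_distrib)
qed


subsection \<open>The Poisson bracket\<close>

lemma poisson_add: "poisson (f + g) h = poisson f h + poisson g h" "poisson h (f + g) = poisson h f + poisson h g"
  by (simp_all add: poisson_def pdiff_add algebra_simps sum.distrib sum_subtractf)

lemma poisson_scale: "poisson (scaleP c f) h = scaleP c (poisson f h)" "poisson h (scaleP c f) = scaleP c (poisson h f)"
  by (simp_all add: poisson_def pdiff_scale scaleP_mult_left scaleP_mult_right cpoly.scale_sum_right cpoly.scale_right_diff_distrib)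

lemma poisson_zz: "poisson (zz i) f = pv (Y i) * pdiff (Y i) f - pv (X i) * pdiff (X i) f"
proof -
  have "poisson (zz i) f = (\<Sum>j\<in>UNIV. if j = i then pv (Y i) * pdiff (Y i) f - pv (X i) * pdiff (X i) f else 0)"
    unfolding poisson_def by (intro sum.cong) (auto simp: pdiff_mult pdiff_pv)
  then show ?thesis by simp
qed

text \<open>\<open>zz i\<close> is the Hamiltonian of the torus acting on the i-th pair: its bracket
  is a difference of two Euler operators.\<close>

lemma poisson_zz_mon: "poisson (zz i) (mon m) = scaleP (- of_int (weight m i)) (mon m)"
  by (simp add: poisson_zz euler weight_def flip: cpoly.scale_left_diff_distrib)

lemma poisson_cube: "poisson (pv (X i) ^ 3) f = 3 * pv (X i) ^ 2 * pdiff (Y i) f"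
proof -
  have "poisson (pv (X i) ^ 3) f = (\<Sum>j\<in>UNIV. if j = i then 3 * pv (X i) ^ 2 * pdiff (Y i) f else 0)"
    unfolding poisson_def by (intro sum.cong) (auto simp: pdiff_power pdiff_pv)
  then show ?thesis by simp
qed

lemma pdiff_prod_pv: "pdiff (g i) (\<Prod>j\<in>UNIV. pv (g j)) = (\<Prod>j\<in>UNIV - {i}. pv (g j))"
  if "inj g" for g :: "'n::finite \<Rightarrow> 'n pvar"
proof -
  have "pdiff (g i) (\<Prod>j\<in>UNIV - {i}. pv (g j)) = 0"
    using that by (intro pdiff_prod_0) (auto simp: pdiff_pv inj_eq)
  then show ?thesis
    by (simp add: prod.remove[of UNIV i] pdiff_mult pdiff_pv)
qed

lemma pdiff_prod_pv_X: "pdiff (X i) (\<Prod>j\<in>UNIV. pv (X j)) = (\<Prod>j\<in>UNIV - {i}. pv (X j))"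
  and pdiff_prod_pv_Y: "pdiff (Y i) (\<Prod>j\<in>UNIV. pv (Y j)) = (\<Prod>j\<in>UNIV - {i}. pv (Y j))"
  for i :: "'n::finite"
  by (rule pdiff_prod_pv; simp add: inj_def)+

lemma pdiff_prod_pv_other: "pdiff (Y i) (\<Prod>j\<in>UNIV. pv (X j)) = 0"
  by (rule pdiff_prod_0) (simp add: pdiff_pv)

lemma poisson_prod: "poisson (\<Prod>i\<in>UNIV. pv (X i)) f = (\<Sum>i\<in>UNIV. (\<Prod>j\<in>UNIV - {i}. pv (X j)) * pdiff (Y i) f)"
  by (simp add: poisson_def pdiff_prod_pv_X pdiff_prod_pv_other)

lemma poisson_in_span: "f \<in> invS \<Longrightarrow> g \<in> invS \<Longrightarrow> poisson f g \<in> poisson_span"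
  unfolding poisson_span_def by (intro cpoly.span_base) blast

lemmas poisson_span_closed = HP0_closed(6-10)

lemma poisson_span_scale_iff: "c \<noteq> 0 \<Longrightarrow> scaleP c f \<in> poisson_span \<longleftrightarrow> f \<in> poisson_span"
  using poisson_span_closed(5)[of "scaleP c f" "inverse c"] poisson_span_closed(5)[of f c] by auto

lemma mon_in_poisson_span:
  assumes "mon m \<in> invS" "weight m i \<noteq> 0"
  shows "mon m \<in> poisson_span"
  using poisson_in_span[OF invS_zz assms(1), of i] assms(2)
  by (simp add: poisson_zz_mon poisson_span_scale_iff del: cpoly.scale_minus_left)

text \<open>The weight of \<open>g\<close> is -3 at \<open>i\<close> and 0 elsewhere. Bracketing
  with the cube of \<open>pv (X i)\<close> multiplies by its square and lowers the exponent of
  \<open>Y i\<close> by one, which balances the two exponents at \<open>a + 2\<close>; the scalar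
  \<open>3 * (a + 3)\<close> is nonzero. The same element serves in the Weyl algebra.\<close>

lemma cube_partner:
  fixes s :: "'n::finite \<Rightarrow> nat" and i a
  defines "g \<equiv> pv (X i) ^ a * pv (Y i) ^ (a + 3) * (\<Prod>j\<in>UNIV - {i}. zz j ^ s j)"
  shows "g \<in> invS"
    and "pdiff (Y i) g = of_nat (a + 3) * pv (X i) ^ a * pv (Y i) ^ (a + 2) * (\<Prod>j\<in>UNIV - {i}. zz j ^ s j)"
proof -
  have "g = zz i ^ a * pv (Y i) ^ 3 * (\<Prod>j\<in>UNIV - {i}. zz j ^ s j)"
    by (simp add: g_def power_mult_distrib power_add)
  then show "g \<in> invS"
    by (simp only:) (intro invS_mult invS_power invS_zz invS_cubes invS_zmon_rest)
  show "pdiff (Y i) g = of_nat (a + 3) * pv (X i) ^ a * pv (Y i) ^ (a + 2) * (\<Prod>j\<in>UNIV - {i}. zz j ^ s j)"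
    by (simp add: g_def pdiff_mult pdiff_power pdiff_pv pdiff_zmon_rest del: of_nat_add)
qed

lemma zmon_in_poisson_span:
  assumes "s i \<ge> 2"
  shows "zmon s \<in> poisson_span"
proof -
  obtain a where a: "s i = a + 2" using assms by (metis add.commute le_Suc_ex)
  let ?g = "pv (X i) ^ a * pv (Y i) ^ (a + 3) * (\<Prod>j\<in>UNIV - {i}. zz j ^ s j)"
  have "poisson (pv (X i) ^ 3) ?g = of_nat (3 * (a + 3)) * zmon s"
    unfolding poisson_cube cube_partner(2) zmon_split[of s i] a
    by (simp add: power_add power_mult_distrib power2_eq_square algebra_simps)
  moreover have "poisson (pv (X i) ^ 3) ?g \<in> poisson_span"
    by (intro poisson_in_span cube_partner(1) invS_cubes)
  moreover have "of_nat (3 * (a + 3)) \<noteq> (0 :: complex)"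
    using of_nat_eq_0_iff[of "3 * (a + 3)", where 'a = complex] by simp
  ultimately show ?thesis
    by (metis of_nat_mult_scaleP poisson_span_scale_iff)
qed

definition zset :: "'n::finite set \<Rightarrow> 'n cpol"
  where "zset T = (\<Prod>i\<in>T. zz i)"

lemma zset_eq_zmon: "zset T = zmon (\<lambda>i. if i \<in> T then 1 else 0)"
proof -
  have "zmon (\<lambda>i. if i \<in> T then 1 else 0) = (\<Prod>i\<in>UNIV. if i \<in> T then zz i else 1)"
    unfolding zmon_def by (rule prod.cong) auto
  then show ?thesis
    by (simp add: zset_def flip: prod.inter_restrict)
qed

lemma invS_zset [simp]: "zset T \<in> invS"
  by (simp add: zset_eq_zmon)

text \<open>In the bracket of the product of all \<open>x\<close> with the product of all
  \<open>y\<close>, the i-th term drops exactly the i-th pair.\<close>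

lemma zset_hyperplanes_in_poisson_span: "(\<Sum>i\<in>UNIV. zset (UNIV - {i})) \<in> poisson_span"
proof -
  have "poisson (\<Prod>i\<in>UNIV. pv (X i)) (\<Prod>i\<in>UNIV. pv (Y i)) = (\<Sum>i\<in>UNIV. zset (UNIV - {i}))"
    by (simp add: poisson_prod pdiff_prod_pv_Y zset_def prod.distrib)
  then show ?thesis
    using poisson_in_span[OF invS_prods] by metis
qed

text \<open>Bracket the product of all \<open>x\<close> with \<open>zz i\<close> times the product
  of all \<open>y\<close>, for an arbitrary fixed \<open>i\<close>. By the Leibniz rule the full
  product appears twice: once from differentiating \<open>zz i\<close>, once from the i-th factor of
  the product. Every other term contains the square of \<open>zz i\<close> and lies in the span
  already.\<close>

lemma zset_UNIV_in_poisson_span: "zset (UNIV :: 'n::finite set) \<in> poisson_span"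
proof -
  fix i :: 'n
  have *: "zz i * zset (UNIV - {j}) \<in> poisson_span" if "j \<noteq> i" for j
  proof -
    have "zset (UNIV - {j}) = zz i * zset (UNIV - {j} - {i})"
      using that by (simp add: zset_def prod.remove[of "UNIV - {j}" i])
    moreover have "zset (UNIV - {j} - {i}) = (\<Prod>l\<in>UNIV - {i}. zz l ^ (if l = j then 0 else 1))"
      unfolding zset_def by (rule prod.mono_neutral_cong_left) auto
    moreover have "zmon (\<lambda>l. if l = i then 2 else if l = j then 0 else 1) =
        zz i ^ 2 * (\<Prod>l\<in>UNIV - {i}. zz l ^ (if l = j then 0 else 1))"
      unfolding zmon_split[of _ i] by (intro arg_cong2[where f = "(*)"] prod.cong) auto
    ultimately have "zz i * zset (UNIV - {j}) = zmon (\<lambda>l. if l = i then 2 else if l = j then 0 else 1)"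
      by (simp only: power2_eq_square mult.assoc)
    then show ?thesis by (simp add: zmon_in_poisson_span[of _ i])
  qed
  have *: "(\<Sum>j\<in>UNIV - {i}. zz i * zset (UNIV - {j})) \<in> poisson_span"
    using * unfolding poisson_span_def by (intro cpoly.span_sum) auto
  have [simp]: "zz i * zset (UNIV - {i}) = zset UNIV"
    by (simp add: zset_def prod.remove[of UNIV i])
  have "poisson (\<Prod>j\<in>UNIV. pv (X j)) (zz i * (\<Prod>j\<in>UNIV. pv (Y j))) =
    (\<Sum>l\<in>UNIV. (if l = i then (\<Prod>j\<in>UNIV - {i}. pv (X j)) * (pv (X i) * (\<Prod>j\<in>UNIV. pv (Y j))) else 0)
      + zz i * zset (UNIV - {l}))"
    unfolding poisson_prod
    by (rule sum.cong) (auto simp: pdiff_mult pdiff_prod_pv_Y pdiff_pv zset_def prod.distrib algebra_simps)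
  also have "\<dots> = (\<Prod>j\<in>UNIV - {i}. pv (X j)) * pv (X i) * (\<Prod>j\<in>UNIV. pv (Y j))
     + (\<Sum>l\<in>UNIV. zz i * zset (UNIV - {l}))"
    by (simp add: sum.distrib mult.assoc)
  also have "(\<Prod>j\<in>UNIV - {i}. pv (X j)) * pv (X i) = (\<Prod>j\<in>UNIV. pv (X j))"
    by (simp add: prod.remove[of UNIV i] mult.commute)
  also have "(\<Prod>j\<in>UNIV. pv (X j)) * (\<Prod>j\<in>UNIV. pv (Y j)) = zset UNIV"
    by (simp add: zset_def prod.distrib)
  also have "(\<Sum>l\<in>UNIV. zz i * zset (UNIV - {l})) = zset UNIV + (\<Sum>l\<in>UNIV - {i}. zz i * zset (UNIV - {l}))"
    by (simp add: sum.remove[of UNIV i])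
  finally have "scaleP 2 (zset UNIV) =
      poisson (\<Prod>j\<in>UNIV. pv (X j)) (zz i * (\<Prod>j\<in>UNIV. pv (Y j))) - (\<Sum>l\<in>UNIV - {i}. zz i * zset (UNIV - {l}))"
    by (simp flip: numeral_mult_scaleP)
  also have "\<dots> \<in> poisson_span"
    by (intro poisson_span_closed(3) * poisson_in_span invS_prods invS_mult invS_zz)
  finally show ?thesis by (simp add: poisson_span_scale_iff)
qed

section \<open>Coefficients of Poisson brackets at squarefree monomials of weight zero\<close>

definition zexp :: "'n set \<Rightarrow> ('n pvar \<Rightarrow>\<^sub>0 nat)"
  where "zexp T = (\<Sum>i\<in>T. Poly_Mapping.single (X i) 1 + Poly_Mapping.single (Y i) 1)"

lemma zset_eq_mon: "zset T = mon (zexp T)"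
  by (simp add: zset_def zexp_def pv_def mult_single prod_single)

lemma lookup_zexp [simp]:
  "Poly_Mapping.lookup (zexp T) (X i) = (if i \<in> T then 1 else 0)"
  "Poly_Mapping.lookup (zexp T) (Y i) = (if i \<in> T then 1 else 0)"
  for T :: "'n::finite set"
  by (simp_all add: zexp_def lookup_sum lookup_add lookup_single when_def)

lemma zexp_inject: "zexp S = zexp T \<longleftrightarrow> S = T" for S T :: "'n::finite set"
proof -
  have "T = {i. Poly_Mapping.lookup (zexp T) (X i) = 1}" for T :: "'n set" by auto
  then show ?thesis by metis
qed

text \<open>Each term of the bracket removes one \<open>X i\<close> and one \<open>Y i\<close>. The
  condition is put additively on \<open>m + n\<close> to avoid truncated subtraction of
  exponents.\<close>

lemma lookup_poisson_mon:
  "Poly_Mapping.lookup (poisson (mon m) (mon n)) t = (\<Sum>i\<in>UNIV.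
    if m + n = t + Poly_Mapping.single (X i) 1 + Poly_Mapping.single (Y i) 1
    then of_nat (Poly_Mapping.lookup m (X i)) * of_nat (Poly_Mapping.lookup n (Y i))
      - of_nat (Poly_Mapping.lookup m (Y i)) * of_nat (Poly_Mapping.lookup n (X i)) else 0)"
proof -
  have *: "Poly_Mapping.lookup (pdiff u (mon m) * pdiff v (mon n)) t =
     (if m + n = t + Poly_Mapping.single u 1 + Poly_Mapping.single v 1
      then of_nat (Poly_Mapping.lookup m u) * of_nat (Poly_Mapping.lookup n v) else 0)" for u v
  proof (cases "Poly_Mapping.lookup m u = 0 \<or> Poly_Mapping.lookup n v = 0")
    case False
    then have "m = Poly_Mapping.single u 1 + (m - Poly_Mapping.single u 1)"
      "n = Poly_Mapping.single v 1 + (n - Poly_Mapping.single v 1)"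
      by (auto intro!: poly_mapping_eqI simp: lookup_add lookup_minus lookup_single when_def)
    then obtain m' n' where mn: "m = Poly_Mapping.single u 1 + m'" "n = Poly_Mapping.single v 1 + n'" by blast
    have "m - Poly_Mapping.single u 1 = m'" "n - Poly_Mapping.single v 1 = n'"
      using mn by simp_all
    moreover have "m + n = t + Poly_Mapping.single u 1 + Poly_Mapping.single v 1 \<longleftrightarrow> m' + n' = t"
    proof -
      have "m + n = (m' + n') + (Poly_Mapping.single u 1 + Poly_Mapping.single v 1)"
        by (simp add: mn ac_simps)
      moreover have "t + Poly_Mapping.single u 1 + Poly_Mapping.single v 1 = t + (Poly_Mapping.single u 1 + Poly_Mapping.single v 1)"
        by (rule add.assoc)
      ultimately show ?thesis by (metis add_right_cancel)
    qed
    ultimately show ?thesis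
      by (simp only: pdiff_mon mult_single lookup_single when_def)
  qed (auto simp: pdiff_mon)
  show ?thesis
    unfolding poisson_def lookup_sum lookup_minus *
    by (rule sum.cong) (simp_all add: ac_simps)
qed

lemma weight_cong:
  assumes "mon m \<in> invS"
  shows "3 dvd weight m i - weight m j"
proof -
  have "(of_int (weight m i - weight m j) :: 3) = 0"
    using assms by (simp add: mon_in_invS)
  then show ?thesis by (simp only: of_int_3_eq_0_iff)
qed

text \<open>Some pair \<open>j\<close> other than \<open>i\<close> is absent from
  \<open>m + n\<close>, so \<open>m\<close> has weight 0 at \<open>j\<close> and its weight at
  \<open>i\<close> is divisible by 3. The exponents at \<open>i\<close> are at most 2, so this
  weight is 0; then \<open>m\<close> and \<open>n\<close> both have equal exponents at
  \<open>X i\<close> and \<open>Y i\<close>, and the determinant vanishes.\<close>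

lemma poisson_term_0:
  fixes T :: "'n::finite set"
  assumes m: "mon m \<in> invS" and T: "insert i T \<noteq> UNIV"
    and mn: "m + n = zexp T + Poly_Mapping.single (X i) 1 + Poly_Mapping.single (Y i) 1"
  shows "of_nat (Poly_Mapping.lookup m (X i)) * of_nat (Poly_Mapping.lookup n (Y i))
      - of_nat (Poly_Mapping.lookup m (Y i)) * of_nat (Poly_Mapping.lookup n (X i)) = (0 :: complex)"
proof -
  obtain j where j: "j \<notin> T" "j \<noteq> i" using T by blast
  note L = arg_cong[OF mn, of "\<lambda>m. Poly_Mapping.lookup m v" for v, unfolded lookup_add]
  have "Poly_Mapping.lookup m (X j) = 0" "Poly_Mapping.lookup m (Y j) = 0"
    using L[of "X j"] L[of "Y j"] j by (simp_all add: lookup_single)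
  then have "3 dvd weight m i"
    using weight_cong[OF m, of i j] by (simp add: weight_def)
  moreover have "Poly_Mapping.lookup m (X i) + Poly_Mapping.lookup n (X i) = (if i \<in> T then 2 else 1)"
    "Poly_Mapping.lookup m (Y i) + Poly_Mapping.lookup n (Y i) = (if i \<in> T then 2 else 1)"
    using L[of "X i"] L[of "Y i"] by (simp_all add: lookup_single)
  ultimately have "Poly_Mapping.lookup m (X i) = Poly_Mapping.lookup m (Y i)"
    "Poly_Mapping.lookup n (X i) = Poly_Mapping.lookup n (Y i)"
    unfolding weight_def by (cases "i \<in> T"; simp; presburger)+
  then show ?thesis by simp
qed

text \<open>The second assumption says that \<open>T\<close> misses at least two indices, so
  \<open>poisson_term_0\<close> covers every summand.\<close>

lemma lookup_poisson_small:
  assumes "mon m \<in> invS" and "\<And>i. insert i T \<noteq> UNIV"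
  shows "Poly_Mapping.lookup (poisson (mon m) (mon n)) (zexp T) = 0"
  unfolding lookup_poisson_mon
  by (rule sum.neutral) (simp only: poisson_term_0[OF assms] if_cancel cong: if_cong, simp)

text \<open>Only the summand at \<open>j\<close> survives. There \<open>X j\<close> and
  \<open>Y j\<close> each occur once in \<open>m + n\<close>, so with exponents \<open>a\<close>,
  \<open>b\<close> of \<open>m\<close> the determinant is a(1 - b) - b(1 - a) = a - b.\<close>

lemma lookup_poisson_hyperplane:
  fixes j :: "'n::finite"
  assumes m: "mon m \<in> invS"
  shows "Poly_Mapping.lookup (poisson (mon m) (mon n)) (zexp (UNIV - {j})) =
    (if m + n = zexp UNIV then of_int (weight m j) else 0)"
proof -
  have U: "zexp (UNIV - {j}) + Poly_Mapping.single (X j) 1 + Poly_Mapping.single (Y j) 1 = zexp UNIV"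
    by (simp add: zexp_def sum.remove[of UNIV j] ac_simps)
  have "Poly_Mapping.lookup (poisson (mon m) (mon n)) (zexp (UNIV - {j})) =
    (\<Sum>i\<in>UNIV. if i = j then
      (if m + n = zexp UNIV
      then of_nat (Poly_Mapping.lookup m (X j)) * of_nat (Poly_Mapping.lookup n (Y j))
      - of_nat (Poly_Mapping.lookup m (Y j)) * of_nat (Poly_Mapping.lookup n (X j)) else 0) else 0)"
    unfolding lookup_poisson_mon
  proof (rule sum.cong)
    fix i
    have "insert i (UNIV - {j}) \<noteq> UNIV" if "i \<noteq> j" using that by auto
    then show "(if m + n = zexp (UNIV - {j}) + Poly_Mapping.single (X i) 1 + Poly_Mapping.single (Y i) 1
      then of_nat (Poly_Mapping.lookup m (X i)) * of_nat (Poly_Mapping.lookup n (Y i))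
      - of_nat (Poly_Mapping.lookup m (Y i)) * of_nat (Poly_Mapping.lookup n (X i)) else 0) =
      (if i = j then
      (if m + n = zexp UNIV
      then of_nat (Poly_Mapping.lookup m (X j)) * of_nat (Poly_Mapping.lookup n (Y j))
      - of_nat (Poly_Mapping.lookup m (Y j)) * of_nat (Poly_Mapping.lookup n (X j)) else 0) else (0::complex))"
      using poisson_term_0[OF m, of i "UNIV - {j}" n] U by (cases "i = j") auto
  qed simp
  also have "\<dots> = (if m + n = zexp UNIV then of_int (weight m j) else 0)"
  proof (cases "m + n = zexp UNIV")
    case True
    note L = arg_cong[OF True, of "\<lambda>m. Poly_Mapping.lookup m v" for v, unfolded lookup_add]
    have "Poly_Mapping.lookup m (X j) + Poly_Mapping.lookup n (X j) = 1"
      "Poly_Mapping.lookup m (Y j) + Poly_Mapping.lookup n (Y j) = 1"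
      using L[of "X j"] L[of "Y j"] by simp_all
    then have "Poly_Mapping.lookup m (X j) = 0 \<and> Poly_Mapping.lookup n (X j) = 1 \<or> Poly_Mapping.lookup m (X j) = 1 \<and> Poly_Mapping.lookup n (X j) = 0"
     "Poly_Mapping.lookup m (Y j) = 0 \<and> Poly_Mapping.lookup n (Y j) = 1 \<or> Poly_Mapping.lookup m (Y j) = 1 \<and> Poly_Mapping.lookup n (Y j) = 0" by arith+
    then show ?thesis using True by (auto simp: weight_def)
  qed simp
  finally show ?thesis .
qed

text \<open>When \<open>m + n = zexp UNIV\<close>, the weights of \<open>m\<close> lie between -1
  and 1 and are congruent modulo 3, hence equal.\<close>

lemma lookup_poisson_hyperplane_eq:
  fixes i j :: "'n::finite"
  assumes m: "mon m \<in> invS"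
  shows "Poly_Mapping.lookup (poisson (mon m) (mon n)) (zexp (UNIV - {i})) =
    Poly_Mapping.lookup (poisson (mon m) (mon n)) (zexp (UNIV - {j}))"
proof -
  have "weight m i = weight m j" if "m + n = zexp UNIV"
  proof -
    note L = arg_cong[OF that, of "\<lambda>m. Poly_Mapping.lookup m v" for v, unfolded lookup_add]
    have "\<bar>weight m l\<bar> \<le> 1" for l
      using L[of "X l"] L[of "Y l"] by (simp add: weight_def)
    from this[of i] this[of j] weight_cong[OF m, of i j] show ?thesis by presburger
  qed
  then show ?thesis by (simp add: lookup_poisson_hyperplane[OF m])
qed

text \<open>The bracket removes pairs of weight zero, so weights add and stay constant modulo
  3.\<close>

lemma poisson_span_subset: "poisson_span \<subseteq> (invS :: 'n::finite cpol set)"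
proof -
  have sub: "cpoly.subspace (invS :: 'n cpol set)" by (rule subspace_invS)
  have "poisson f g \<in> invS" if "f \<in> invS" "g \<in> invS" for f g :: "'n cpol"
    using that
  proof (induction f rule: invS_induct)
    case (mon m)
    from mon(2,1) show ?case
    proof (induction g rule: invS_induct)
      case (mon n)
      show ?case
      proof (rule invS_if_keys)
        fix t
        assume "Poly_Mapping.lookup (poisson (mon m) (mon n)) t \<noteq> 0"
        then have "\<exists>i. m + n = t + Poly_Mapping.single (X i) 1 + Poly_Mapping.single (Y i) 1"
          unfolding lookup_poisson_mon by (rule contrapos_np) (auto intro: sum.neutral)
        then obtain i where "m + n = t + Poly_Mapping.single (X i) 1 + Poly_Mapping.single (Y i) 1"
          by blast
        note L = arg_cong[OF this, of "\<lambda>m. Poly_Mapping.lookup m v" for v, unfolded lookup_add]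
        have "weight t j = weight m j + weight n j" for j
          using L[of "X j"] L[of "Y j"] by (simp add: weight_def lookup_single when_def split: if_splits)
        then show "mon t \<in> invS" using mon(1,2) by (simp add: mon_in_invS) metis
      qed
    qed (simp_all add: poisson_add poisson_scale HP0_closed)
  qed (simp_all add: poisson_add poisson_scale HP0_closed)
  then show ?thesis
    unfolding poisson_span_def by (intro cpoly.span_minimal sub) auto
qed

section \<open>Dimension of the Poisson quotient\<close>

lemma dim_HP0_UNIV: "int (HP0.dim (UNIV :: 'n::finite HP0 set)) = 2 ^ CARD('n) - 2"
proof -
  fix i0 :: 'n
  let ?U = "UNIV - {i0}"
  let ?B = "UNIV - {UNIV, ?U} :: 'n set set"
  \<comment> \<open>Brackets have coefficient 0 at sets missing two or more indices, and equal
    coefficients at all complements of a point. Subtracting the coefficient at \<open>?U\<close>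
    therefore kills them in the second case too, and it does not disturb duality since
    \<open>?U\<close> is not in \<open>?B\<close>.\<close>
  define lam :: "'n set \<Rightarrow> 'n cpol \<Rightarrow> complex" where
    "lam T f = Poly_Mapping.lookup f (zexp T) -
      (if \<exists>i. T = UNIV - {i} then Poly_Mapping.lookup f (zexp ?U) else 0)" for T f
  have add: "lam T (f + g) = lam T f + lam T g" and scale: "lam T (scaleP c f) = c * lam T f" for T f g c
    by (auto simp: lam_def lookup_add algebra_simps)
  have bracket: "lam T (poisson f g) = 0" if "T \<in> ?B" "f \<in> invS" "g \<in> invS" for T f g
    using that(2,3)
  proof (induction f rule: invS_induct)
    case (mon m)
    from mon(2,1) show ?case
    proof (induction g rule: invS_induct)
      case (mon n)
      show ?case
      proof (cases "\<exists>i. T = UNIV - {i}")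
        case True
        then obtain i where "T = UNIV - {i}" by blast
        then show ?thesis
          using lookup_poisson_hyperplane_eq[OF mon(2), of n i i0] by (auto simp: lam_def)
      next
        case False
        have "insert i T \<noteq> UNIV" for i
        proof
          assume "insert i T = UNIV"
          then have "T = UNIV \<or> T = UNIV - {i}" by (cases "i \<in> T") auto
          with False that(1) show False by auto
        qed
        then show ?thesis
          using False by (simp add: lam_def lookup_poisson_small[OF mon(2)])
      qed
    qed (simp_all add: poisson_add poisson_scale add scale)
  qed (simp_all add: poisson_add poisson_scale add scale)
  have "HP0.dim (UNIV :: 'n HP0 set) = card ?B"
  proof (rule dim_HP0[of ?B zset lam, OF _ _ add scale])
    show "lam T v = 0" if "T \<in> ?B" "v \<in> poisson_span" for T v
      using that(2) unfolding poisson_span_def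
    proof (induction rule: cpoly.span_induct_alt)
      case base
      then show ?case by (simp add: lam_def)
    next
      case (step c x y)
      then show ?case using bracket[OF that(1)] by (auto simp: add scale)
    qed
    show "(lam S (zset T) \<noteq> 0) = (S = T)" if "S \<in> ?B" "T \<in> ?B" for S T
      using that by (auto simp: lam_def zset_eq_mon lookup_single when_def zexp_inject)
    show "invS \<subseteq> cpoly.span (poisson_span \<union> zset ` ?B)" (is "_ \<subseteq> ?S")
    proof
      have W: "f \<in> ?S" if "f \<in> poisson_span" for f
        using that by (intro cpoly.span_base) blast
      have B: "zset T \<in> ?S" if "T \<in> ?B" for T
        using that by (intro cpoly.span_base) blast
      have zset: "zset T \<in> ?S" for T
      proof -
        consider "T \<in> ?B" | "T = UNIV" | "T = ?U" by blast
        then show ?thesis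
        proof cases
          \<comment> \<open>The relation between the complements of points expresses the one at
            \<open>i0\<close> through the others.\<close>
          case 3
          have "zset (UNIV - {i}) \<in> ?S" if "i \<noteq> i0" for i
            using that by (intro B) auto
          then have "(\<Sum>i\<in>UNIV - {i0}. zset (UNIV - {i})) \<in> ?S"
            by (intro cpoly.span_sum) auto
          with W[OF zset_hyperplanes_in_poisson_span]
          have "(\<Sum>i\<in>UNIV. zset (UNIV - {i})) - (\<Sum>i\<in>UNIV - {i0}. zset (UNIV - {i})) \<in> ?S"
            by (rule cpoly.span_diff)
          then show ?thesis by (simp add: 3 sum.remove[of UNIV i0])
        qed (use B W[OF zset_UNIV_in_poisson_span] in auto)
      qed
      fix f :: "'n cpol"
      assume "f \<in> invS"
      then show "f \<in> ?S"
      proof (induction f rule: invS_induct)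
        case (mon m)
        show ?case
        proof (cases "\<exists>i. weight m i \<noteq> 0")
          case True
          then show ?thesis using W mon_in_poisson_span[OF mon] by blast
        next
          case False
          then have m: "mon m = zmon (\<lambda>i. Poly_Mapping.lookup m (X i))"
            by (intro mon_weight_0) auto
          show ?thesis
          proof (cases "\<exists>i. Poly_Mapping.lookup m (X i) \<ge> 2")
            case True
            then show ?thesis using W zmon_in_poisson_span m by metis
          next
            case False
            define T where "T = {i. Poly_Mapping.lookup m (X i) = 1}"
            have "(\<lambda>i. Poly_Mapping.lookup m (X i)) = (\<lambda>i. if i \<in> T then 1 else 0)"
              using False by (intro ext) (auto simp: T_def not_le less_2_cases_iff)
            then have "mon m = zset T"
              by (simp only: m zset_eq_zmon)
            then show ?thesis using zset by metis
          qed
        qed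
      qed (auto intro: cpoly.span_add cpoly.span_scale)
    qed
    show "poisson_span \<subseteq> invS" by (rule poisson_span_subset)
  qed simp_all
  moreover have "card ?B = card (UNIV :: 'n set set) - card {UNIV, ?U}"
    by (rule card_Diff_subset) auto
  moreover have "card {UNIV, ?U} = 2" by (simp add: card_insert_if) blast
  moreover have "card (UNIV :: 'n set set) = 2 ^ CARD('n)"
    using card_Pow[of "UNIV :: 'n set"] by simp
  \<comment> \<open>This makes the natural subtraction of 2 a genuine one.\<close>
  moreover have "(2::nat) ^ 1 \<le> 2 ^ CARD('n)"
    by (rule power_increasing) (auto simp: Suc_le_eq)
  ultimately show ?thesis by (simp add: of_nat_diff)
qed


subsection \<open>Normal ordering in the Weyl algebra\<close>

lemma scaleA_mult_left: "scaleA c a * b = scaleA c (a * b)"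
  and scaleA_mult_right: "a * scaleA c b = scaleA c (a * b)"
  by (transfer, simp add: scaleP_mult_left, transfer, simp add: scaleP_mult_right)

lemma weyl_induct [case_names add scale one var]:
  assumes "\<And>a b. R a \<Longrightarrow> R b \<Longrightarrow> R (a + b)" "\<And>c a. R a \<Longrightarrow> R (scaleA c a)"
    and "R 1" and "\<And>g a. R a \<Longrightarrow> R (wv g * a)"
  shows "R (a :: 'n weyl)"
proof -
  have "R (abs_weyl f)" for f :: "'n free_alg"
  proof (induction f rule: cpol_linear_induct)
    case (mon w)
    show ?case
    proof (cases w)
      case (Word l)
      have "R (abs_weyl (Poly_Mapping.single (Word l) 1))"
      proof (induction l)
        case Nil
        then show ?case using assms(3) by (simp add: one_weyl_def flip: zero_word_def)
      next
        case (Cons g l)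
        have "Poly_Mapping.single (Word (g # l)) 1 = fv g * Poly_Mapping.single (Word l) (1 :: complex)"
          by (simp add: fv_def mult_single plus_word_def)
        then show ?case
          using assms(4)[OF Cons, of g] by (simp add: wv_def times_weyl.abs_eq)
      qed
      then show ?thesis by (simp add: Word)
    qed
  next
    case (add f g)
    then show ?case using assms(1) by (simp flip: plus_weyl.abs_eq)
  next
    case (scale c f)
    then show ?case using assms(2) by (simp flip: scaleA.abs_eq)
  qed
  then show ?thesis by (metis Quotient3_abs_rep Quotient3_weyl)
qed

lemma commutation:
  "wv (P i) * wv (Q j) = wv (Q j) * wv (P i) + (if i = j then 1 else 0)"
  "wv (P i) * wv (P j) = wv (P j) * wv (P i)"
  "wv (Q i) * wv (Q j) = wv (Q j) * wv (Q i)"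
  using weyl_generators[of i j] by (simp_all add: commutator_def algebra_simps)

lemma pdiff_commute: "pdiff u (pdiff v f) = pdiff v (pdiff u f)"
  for f :: "'n::finite cpol"
  by (induction f rule: cpol_induct) (auto simp: pdiff_add pdiff_scale pdiff_mult pdiff_pv)

section \<open>Action of the Weyl algebra on normally ordered symbols\<close>

text \<open>Left multiplication by a generator, read on symbols whose \<open>Q\<close>s stand left
  of the \<open>P\<close>s: moving \<open>P i\<close> past the \<open>Q\<close>s contributes the
  derivative in \<open>Y i\<close>.\<close>

fun wop :: "'n wgen \<Rightarrow> 'n cpol \<Rightarrow> 'n cpol" where
  "wop (P i) f = pv (X i) * f + pdiff (Y i) f"
| "wop (Q i) f = pv (Y i) * f"

lemma wop_add: "wop g (f + h) = wop g f + wop g h"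
  and wop_scale: "wop g (scaleP c f) = scaleP c (wop g f)"
  by (cases g; simp add: pdiff_add pdiff_scale algebra_simps scaleP_mult_right cpoly.scale_right_distrib)+

lemma foldr_wop_add: "foldr wop l (f + h) = foldr wop l f + foldr wop l h"
  and foldr_wop_scale: "foldr wop l (scaleP c f) = scaleP c (foldr wop l f)"
  by (induction l) (simp_all add: wop_add wop_scale)

definition free_act :: "'n free_alg \<Rightarrow> 'n cpol \<Rightarrow> 'n cpol"
  where "free_act a f = lin_ext (\<lambda>w. foldr wop (letters w) f) a"

lemma free_act_add_left: "free_act (a + b) f = free_act a f + free_act b f"
  and free_act_diff_left: "free_act (a - b) f = free_act a f - free_act b f"
  and free_act_scale_left: "free_act (scaleP c a) f = scaleP c (free_act a f)"
  and free_act_0_left [simp]: "free_act 0 f = 0"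
  by (simp_all add: free_act_def lin_ext_add lin_ext_diff lin_ext_scale)

lemma free_act_word: "free_act (Poly_Mapping.single w 1) f = foldr wop (letters w) f"
  by (simp add: free_act_def)

lemma free_act_1 [simp]: "free_act 1 f = f"
  using free_act_word[of 0 f] by (simp add: zero_word_def flip: single_one)

lemma free_act_add: "free_act a (f + h) = free_act a f + free_act a h"
  by (induction a rule: cpol_linear_induct)
    (simp_all add: free_act_add_left free_act_scale_left free_act_word foldr_wop_add cpoly.scale_right_distrib)

lemma free_act_scale: "free_act a (scaleP c f) = scaleP c (free_act a f)"
  by (induction a rule: cpol_linear_induct)
    (simp_all add: free_act_add_left free_act_scale_left free_act_word foldr_wop_scale cpoly.scale_right_distrib
      cpoly.scale_left_commute)

lemma free_act_0 [simp]: "free_act a 0 = 0"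
  using free_act_scale[of a 0 0] by simp

lemma free_act_mult: "free_act (a * b) f = free_act a (free_act b f)"
proof (induction a rule: cpol_linear_induct)
  case (mon v)
  show ?case
  proof (induction b rule: cpol_linear_induct)
    case (mon w)
    show ?case by (simp add: mult_single free_act_word plus_word_def)
  qed (simp_all add: distrib_left free_act_add_left scaleP_mult_right free_act_scale_left free_act_add free_act_scale)
qed (simp_all add: distrib_right free_act_add_left scaleP_mult_left free_act_scale_left)

lemma free_act_fv [simp]: "free_act (fv g) f = wop g f"
  by (simp add: fv_def free_act_word)

text \<open>By the Leibniz rule the operators \<open>wop\<close> satisfy the canonical commutation
  relations; the action thereby descends to the Weyl algebra.\<close>

lemma free_act_relators: "r \<in> weyl_relators \<Longrightarrow> free_act r f = 0"
  for f :: "'n::finite cpol"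
  unfolding weyl_relators_def commutator_def
  by (elim UnE CollectE exE conjE; hypsubst;
      simp add: free_act_add_left free_act_diff_left free_act_mult pdiff_add pdiff_mult pdiff_pv pdiff_commute algebra_simps)

lemma free_act_ideal: "free_act a f = 0" if "a \<in> weyl_ideal"
  for f :: "'n::finite cpol"
  using that unfolding weyl_ideal_def
proof (induction rule: cpoly.span_induct_alt)
  case (step c x y)
  then obtain u r v where "x = u * r * v" "r \<in> weyl_relators" by blast
  then show ?case using step
    by (simp add: free_act_add_left free_act_scale_left free_act_mult free_act_relators)
qed simp

lift_definition weyl_act :: "'n::finite weyl \<Rightarrow> 'n cpol \<Rightarrow> 'n cpol" is free_act
proof (rule ext)
  fix a b :: "'n free_alg" and f
  assume "weyl_rel a b"
  then show "free_act a f = free_act b f"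
    using free_act_ideal[of "a - b" f] by (simp add: weyl_rel_def free_act_diff_left)
qed

lemma weyl_act_simps:
  "weyl_act (a + b) f = weyl_act a f + weyl_act b f"
  "weyl_act (a * b) f = weyl_act a (weyl_act b f)"
  "weyl_act (scaleA c a) f = scaleP c (weyl_act a f)"
  "weyl_act 1 f = f"
  "weyl_act (wv g) f = wop g f"
  by (transfer, simp add: free_act_add_left, transfer, simp add: free_act_mult,
      transfer, simp add: free_act_scale_left, transfer, simp, transfer, simp)

text \<open>The operators \<open>wop\<close> differentiate only in the \<open>Y\<close> variables.
  This is what identifies right multiplication by \<open>P i\<close> on symbols.\<close>

lemma weyl_act_pv_X: "weyl_act a (pv (X i) * f) = pv (X i) * weyl_act a f"
proof (induction a rule: weyl_induct)
  case (var g a)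
  then show ?case by (cases g) (simp_all add: weyl_act_simps pdiff_mult pdiff_pv algebra_simps)
qed (simp_all add: weyl_act_simps algebra_simps scaleP_mult_right)

definition symb :: "'n::finite weyl \<Rightarrow> 'n cpol"
  where "symb a = weyl_act a 1"

lemma symb_simps:
  "symb (a + b) = symb a + symb b"
  "symb (scaleA c a) = scaleP c (symb a)"
  "symb 1 = 1"
  "symb (wv g * a) = wop g (symb a)"
  by (simp_all add: symb_def weyl_act_simps)

lemma symb_mult_P: "symb (a * wv (P i)) = pv (X i) * symb a"
  using weyl_act_pv_X[of a i 1] by (simp add: symb_def weyl_act_simps)

text \<open>Left multiplication by the \<open>Q i\<close> and right multiplication by the \<open>P i\<close> are pairwise
  commuting operators, so a monomial can be evaluated at them in any order.\<close>

fun vmult :: "'n pvar \<Rightarrow> 'n weyl \<Rightarrow> 'n weyl" where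
  "vmult (X i) a = a * wv (P i)"
| "vmult (Y i) a = wv (Q i) * a"

lemma vmult_commute: "vmult u (vmult v a) = vmult v (vmult u a)"
proof -
  have "a * wv (P i) * wv (P j) = a * wv (P j) * wv (P i)" for i j
    by (simp only: mult.assoc commutation)
  moreover have "wv (Q i) * (wv (Q j) * a) = wv (Q j) * (wv (Q i) * a)" for i j
    by (simp only: commutation flip: mult.assoc)
  ultimately show ?thesis
    by (cases u; cases v) (simp_all add: mult.assoc)
qed

lemma vmult_linear: "vmult v (a + b) = vmult v a + vmult v b" "vmult v (scaleA c a) = scaleA c (vmult v a)"
  by (cases v; simp add: algebra_simps scaleA_mult_left scaleA_mult_right)+

definition normal_mon :: "('n::finite pvar \<Rightarrow>\<^sub>0 nat) \<Rightarrow> 'n weyl"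
  where "normal_mon m = Finite_Set.fold (\<lambda>v. vmult v ^^ Poly_Mapping.lookup m v) 1 UNIV"

lemma comp_fun_commute_vmult: "comp_fun_commute_on UNIV (\<lambda>v. vmult v ^^ k v)"
  for k :: "'n::finite pvar \<Rightarrow> nat"
proof
  fix u v :: "'n pvar"
  have 1: "(vmult u ^^ a) (vmult v x) = vmult v ((vmult u ^^ a) x)" for a x
    by (induction a) (simp_all add: vmult_commute)
  have "(vmult u ^^ a) ((vmult v ^^ b) x) = (vmult v ^^ b) ((vmult u ^^ a) x)" for a b x
    by (induction b) (simp_all add: 1)
  then show "vmult v ^^ k v \<circ> vmult u ^^ k u = vmult u ^^ k u \<circ> vmult v ^^ k v"
    by (auto simp: fun_eq_iff)
qed

lemma normal_mon_0: "normal_mon 0 = (1 :: 'n::finite weyl)"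
proof -
  have "Finite_Set.fold (\<lambda>v a. a) 1 A = (1 :: 'n weyl)" if "finite A" for A :: "'n pvar set"
  proof -
    interpret comp_fun_commute_on UNIV "\<lambda>v :: 'n pvar. \<lambda>a :: 'n weyl. a" by standard simp
    show ?thesis using that by (induction A rule: finite_induct) simp_all
  qed
  then show ?thesis by (simp add: normal_mon_def id_def)
qed

text \<open>Since the order of the fold is free, \<open>v\<close> can be made the outermost
  operator, and one more power of it is one more application of \<open>vmult v\<close>.\<close>

lemma normal_mon_var: "normal_mon (Poly_Mapping.single v 1 + m) = vmult v (normal_mon m)"
proof -
  have *: "normal_mon m = (vmult v ^^ Poly_Mapping.lookup m v)
      (Finite_Set.fold (\<lambda>v. vmult v ^^ Poly_Mapping.lookup m v) 1 (UNIV - {v}))" for m :: "'a pvar \<Rightarrow>\<^sub>0 nat"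
    unfolding normal_mon_def by (rule comp_fun_commute_on.fold_rec[OF comp_fun_commute_vmult]) auto
  have "Finite_Set.fold (\<lambda>w. vmult w ^^ Poly_Mapping.lookup (Poly_Mapping.single v 1 + m) w) 1 (UNIV - {v})
      = Finite_Set.fold (\<lambda>v. vmult v ^^ Poly_Mapping.lookup m v) 1 (UNIV - {v})"
    by (rule Finite_Set.fold_cong[where S = UNIV])
      (auto simp: lookup_add lookup_single intro!: comp_fun_commute_vmult)
  then show ?thesis
    by (simp add: * lookup_add)
qed

text \<open>\<open>lin_ext\<close> takes values in monoid algebras, so the extension is formed on
  representatives in the free algebra; their choice disappears under
  \<open>abs_weyl\<close>.\<close>

definition normal :: "'n::finite cpol \<Rightarrow> 'n weyl"
  where "normal f = abs_weyl (lin_ext (\<lambda>m. rep_weyl (normal_mon m)) f)"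

lemma normal_add: "normal (f + g) = normal f + normal g"
  and normal_scale: "normal (scaleP c f) = scaleA c (normal f)"
  by (simp_all add: normal_def lin_ext_add lin_ext_scale plus_weyl.abs_eq scaleA.abs_eq)

lemma normal_0 [simp]: "normal 0 = 0"
  using normal_scale[of 0 0] by simp

lemma normal_mon: "normal (mon m) = normal_mon m"
  using Quotient3_abs_rep[OF Quotient3_weyl] by (simp add: normal_def)

lemma normal_1 [simp]: "normal 1 = 1"
  using normal_mon[of 0] by (simp add: normal_mon_0)

lemma normal_var: "normal (pv v * f) = vmult v (normal f)"
proof (induction f rule: cpol_linear_induct)
  case (mon m)
  show ?case by (simp add: pv_def mult_single normal_mon normal_mon_var del: One_nat_def)
qed (simp_all add: distrib_left normal_add scaleP_mult_right normal_scale vmult_linear)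

lemma normal_pv: "normal (pv (X i)) = wv (P i)" "normal (pv (Y i)) = wv (Q i)"
  using normal_var[of "X i" 1] normal_var[of "Y i" 1] by simp_all

lemma normal_mult_P_right: "normal f * wv (P i) = normal (pv (X i) * f)"
  and normal_mult_Q_left: "wv (Q i) * normal f = normal (pv (Y i) * f)"
  by (simp_all add: normal_var)

text \<open>Induction on the variables of \<open>f\<close>: a \<open>P j\<close> is appended on the
  right and does not interact with \<open>P i\<close>, while a \<open>Q j\<close> is put in front
  and its commutator with \<open>P i\<close> supplies the new Leibniz term.\<close>

lemma normal_mult_P_left: "wv (P i) * normal f = normal (pv (X i) * f + pdiff (Y i) f)"
proof (induction f rule: cpol_induct)
  case (add f g)
  then show ?case by (simp add: distrib_left pdiff_add normal_add add_ac)
next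
  case (scale c f)
  then show ?case by (simp add: scaleP_mult_right scaleA_mult_right pdiff_scale normal_add normal_scale weyl.scale_right_distrib)
next
  case one
  then show ?case by (simp add: normal_pv)
next
  case (var v f)
  show ?case
  proof (cases v)
    case (X j)
    have "pv (X i) * (pv v * f) + pdiff (Y i) (pv v * f) = pv v * (pv (X i) * f + pdiff (Y i) f)"
      by (simp add: X pdiff_mult pdiff_pv algebra_simps)
    then have "normal (pv (X i) * (pv v * f) + pdiff (Y i) (pv v * f)) = (wv (P i) * normal f) * wv (P j)"
      by (simp add: normal_var var) (simp add: X)
    then show ?thesis by (simp add: normal_var X mult.assoc)
  next
    case (Y j)
    have "pv (X i) * (pv v * f) + pdiff (Y i) (pv v * f) =
       pv v * (pv (X i) * f + pdiff (Y i) f) + (if i = j then f else 0)"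
      by (simp add: Y pdiff_mult pdiff_pv algebra_simps)
    then have "normal (pv (X i) * (pv v * f) + pdiff (Y i) (pv v * f)) =
      wv (Q j) * (wv (P i) * normal f) + (if i = j then normal f else 0)"
      by (simp only: normal_add normal_var var) (simp add: Y normal_add)
    also have "\<dots> = wv (P i) * wv (Q j) * normal f"
      by (simp add: commutation(1) distrib_right mult.assoc)
    finally show ?thesis by (simp add: normal_var Y mult.assoc)
  qed
qed

text \<open>Mirror image: moving \<open>Q i\<close> leftwards past the \<open>P\<close>s
  differentiates in \<open>X i\<close>.\<close>

lemma normal_mult_Q_right: "normal f * wv (Q i) = normal (pv (Y i) * f + pdiff (X i) f)"
proof (induction f rule: cpol_induct)
  case (add f g)
  then show ?case by (simp add: distrib_left distrib_right pdiff_add normal_add add_ac)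
next
  case (scale c f)
  then show ?case by (simp add: scaleP_mult_right scaleA_mult_left pdiff_scale normal_add normal_scale weyl.scale_right_distrib)
next
  case one
  then show ?case by (simp add: normal_pv)
next
  case (var v f)
  show ?case
  proof (cases v)
    case (Y j)
    have "pv (Y i) * (pv v * f) + pdiff (X i) (pv v * f) = pv v * (pv (Y i) * f + pdiff (X i) f)"
      by (simp add: Y pdiff_mult pdiff_pv algebra_simps)
    then have "normal (pv (Y i) * (pv v * f) + pdiff (X i) (pv v * f)) = wv (Q j) * (normal f * wv (Q i))"
      by (simp add: normal_var var) (simp add: Y)
    then show ?thesis by (simp add: normal_var Y mult.assoc)
  next
    case (X j)
    have "pv (Y i) * (pv v * f) + pdiff (X i) (pv v * f) =
       pv v * (pv (Y i) * f + pdiff (X i) f) + (if j = i then f else 0)"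
      by (simp add: X pdiff_mult pdiff_pv algebra_simps)
    then have "normal (pv (Y i) * (pv v * f) + pdiff (X i) (pv v * f)) =
      (normal f * wv (Q i)) * wv (P j) + (if j = i then normal f else 0)"
      by (simp only: normal_add normal_var var) (simp add: X normal_add)
    also have "\<dots> = normal f * (wv (P j) * wv (Q i))"
      by (simp add: commutation(1) distrib_left mult.assoc)
    finally show ?thesis by (simp add: normal_var X mult.assoc)
  qed
qed

text \<open>Both maps fix 1 and intertwine left multiplication by a generator with
  \<open>wop\<close>. Together with \<open>symb_normal\<close> this is the PBW theorem: normally
  ordered monomials form a basis.\<close>

lemma normal_symb [simp]: "normal (symb a) = a"
proof (induction a rule: weyl_induct)
  case (var g a)
  then show ?case
    by (cases g) (simp_all add: symb_simps flip: normal_mult_P_left normal_mult_Q_left)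
qed (simp_all add: symb_simps normal_add normal_scale)

lemma symb_normal [simp]: "symb (normal f) = f"
proof (induction f rule: cpol_induct)
  case (var v f)
  then show ?case by (cases v) (simp_all add: normal_var symb_simps symb_mult_P)
qed (simp_all add: normal_add normal_scale symb_simps)

lemma symb_mult_Q: "symb (a * wv (Q i)) = pv (Y i) * symb a + pdiff (X i) (symb a)"
  using arg_cong[OF normal_mult_Q_right[of "symb a" i], of symb] by simp

lemma actA_wv:
  "actA k (wv (P i)) = scaleA (chi (k i)) (wv (P i))"
  "actA k (wv (Q i)) = scaleA (inverse (chi (k i))) (wv (Q i))"
  by (simp_all add: actA_generators chi_def power_int_minus)

lemma actA_normal: "actA k (normal f) = normal (actS k f)"
proof (induction f rule: cpol_induct)
  case (var v f)
  then show ?case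
    by (cases v) (simp_all add: normal_var actA_algebra_hom actS_mult actS_pv actA_wv
      scaleP_mult_left normal_scale scaleA_mult_left scaleA_mult_right)
next
  case one
  have "actS k 1 = 1" using actS_mon[of k 0] by (simp add: weight_def)
  then show ?case by (simp add: actA_algebra_hom)
qed (simp_all add: normal_add normal_scale actA_algebra_hom actS_add actS_scale)

lemma normal_in_invA: "normal f \<in> invA \<longleftrightarrow> f \<in> invS"
  unfolding invA_def invS_def by (simp add: actA_normal) (metis symb_normal)


subsection \<open>Twisted traces\<close>

text \<open>To obtain a scalar-valued functional from \<open>lin_ext\<close>, values are stored in
  degree 0 of a one-variable polynomial algebra and read off there.\<close>

definition tau :: "('n::finite \<Rightarrow> complex) \<Rightarrow> 'n cpol \<Rightarrow> complex"
  where "tau t f = Poly_Mapping.lookup (lin_ext (\<lambda>m. Poly_Mapping.single (0::nat)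
    (if \<forall>i. weight m i = 0
     then \<Prod>i\<in>UNIV. fact (Poly_Mapping.lookup m (X i)) * t i ^ Poly_Mapping.lookup m (X i)
     else 0)) f) 0"

lemma tau_add: "tau t (f + g) = tau t f + tau t g"
  and tau_scale: "tau t (scaleP c f) = c * tau t f"
  by (simp_all add: tau_def lin_ext_add lin_ext_scale lookup_add)

lemma tau_0 [simp]: "tau t 0 = 0"
  by (simp add: tau_def)

lemma tau_mon: "tau t (mon m) =
    (if \<forall>i. weight m i = 0
     then \<Prod>i\<in>UNIV. fact (Poly_Mapping.lookup m (X i)) * t i ^ Poly_Mapping.lookup m (X i)
     else 0)"
  by (simp add: tau_def)

lemma tau_mon_zz: "tau t (mon (m + Poly_Mapping.single (X i) 1 + Poly_Mapping.single (Y i) 1)) =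
    of_nat (Poly_Mapping.lookup m (X i) + 1) * t i * tau t (mon m)"
proof -
  let ?m = "m + Poly_Mapping.single (X i) 1 + Poly_Mapping.single (Y i) 1"
  have X: "Poly_Mapping.lookup ?m (X j) = Poly_Mapping.lookup m (X j) + (if j = i then 1 else 0)"
    and Y: "Poly_Mapping.lookup ?m (Y j) = Poly_Mapping.lookup m (Y j) + (if j = i then 1 else 0)" for j
    by (simp_all add: lookup_add lookup_single when_def)
  have w: "weight ?m j = weight m j" for j
    unfolding weight_def X Y by simp
  have "(\<Prod>j\<in>UNIV. fact (Poly_Mapping.lookup ?m (X j)) * t j ^ Poly_Mapping.lookup ?m (X j)) =
    of_nat (Poly_Mapping.lookup m (X i) + 1) * t i * (\<Prod>j\<in>UNIV. fact (Poly_Mapping.lookup m (X j)) * t j ^ Poly_Mapping.lookup m (X j))"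
    unfolding X by (simp add: prod.remove[of UNIV i] algebra_simps)
  then show ?thesis unfolding tau_mon w by simp
qed

text \<open>Gaussian integration by parts: \<open>tau\<close> is the moment functional in which the
  a-th power of \<open>x i * y i\<close> has expectation a! times the a-th power of
  \<open>t i\<close>. Monomials that are unbalanced at \<open>i\<close> give zero.\<close>

lemma tau_pdiff:
  "tau t (pv (X i) * f) = t i * tau t (pdiff (Y i) f)"
  "tau t (pv (Y i) * f) = t i * tau t (pdiff (X i) f)"
proof -
  show "tau t (pv (X i) * f) = t i * tau t (pdiff (Y i) f)"
  proof (induction f rule: cpol_linear_induct)
    case (mon m)
    show ?case
    proof (cases "Poly_Mapping.lookup m (Y i) = 0")
      case True
      then have "weight (Poly_Mapping.single (X i) 1 + m) i \<noteq> 0"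
        by (simp add: weight_def lookup_add lookup_single)
      then have "tau t (mon (Poly_Mapping.single (X i) 1 + m)) = 0"
        unfolding tau_mon by auto
      then show ?thesis using True by (simp add: pdiff_mon pv_def mult_single)
    next
      case False
      define n where "n = m - Poly_Mapping.single (Y i) 1"
      have m: "m = n + Poly_Mapping.single (Y i) 1"
        using False by (intro poly_mapping_eqI) (auto simp: n_def lookup_add lookup_minus lookup_single when_def)
      have "pv (X i) * mon m = mon (n + Poly_Mapping.single (X i) 1 + Poly_Mapping.single (Y i) 1)"
        by (simp add: pv_def mult_single m ac_simps)
      moreover have "pdiff (Y i) (mon m) = scaleP (of_nat (Poly_Mapping.lookup n (Y i) + 1)) (mon n)"
        by (simp add: pdiff_mon m lookup_add scaleP_mon del: of_nat_add)
      \<comment> \<open>The derivative produces the exponent of \<open>Y i\<close>, whereas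
        \<open>tau_mon_zz\<close> uses that of \<open>X i\<close>; they agree unless
        \<open>tau\<close> vanishes.\<close>
      moreover have "tau t (mon n) = 0 \<or> Poly_Mapping.lookup n (Y i) = Poly_Mapping.lookup n (X i)"
        by (auto simp: tau_mon weight_def)
      ultimately show ?thesis
        by (elim disjE; simp only: tau_scale tau_mon_zz; simp)
    qed
  qed (simp_all add: distrib_left pdiff_add tau_add scaleP_mult_right pdiff_scale tau_scale)
  show "tau t (pv (Y i) * f) = t i * tau t (pdiff (X i) f)"
  proof (induction f rule: cpol_linear_induct)
    case (mon m)
    show ?case
    proof (cases "Poly_Mapping.lookup m (X i) = 0")
      case True
      then have "weight (Poly_Mapping.single (Y i) 1 + m) i \<noteq> 0"
        by (simp add: weight_def lookup_add lookup_single)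
      then have "tau t (mon (Poly_Mapping.single (Y i) 1 + m)) = 0"
        unfolding tau_mon by auto
      then show ?thesis using True by (simp add: pdiff_mon pv_def mult_single)
    next
      case False
      define n where "n = m - Poly_Mapping.single (X i) 1"
      have m: "m = n + Poly_Mapping.single (X i) 1"
        using False by (intro poly_mapping_eqI) (auto simp: n_def lookup_add lookup_minus lookup_single when_def)
      have "pv (Y i) * mon m = mon (n + Poly_Mapping.single (X i) 1 + Poly_Mapping.single (Y i) 1)"
        by (simp add: pv_def mult_single m ac_simps)
      moreover have "pdiff (X i) (mon m) = scaleP (of_nat (Poly_Mapping.lookup n (X i) + 1)) (mon n)"
        by (simp add: pdiff_mon m lookup_add scaleP_mon del: of_nat_add)
      ultimately show ?thesis
        by (simp only: tau_scale tau_mon_zz; simp)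
    qed
  qed (simp_all add: distrib_left pdiff_add tau_add scaleP_mult_right pdiff_scale tau_scale)
qed

text \<open>The solution of \<open>(chi a - 1) * t = 1\<close>, which the twisted trace property
  demands on generators; at \<open>a = 0\<close> it takes the default value 0 of division by
  zero.\<close>

definition tw :: "3 \<Rightarrow> complex"
  where "tw a = 1 / (chi a - 1)"

definition Tr :: "('n::finite \<Rightarrow> 3) \<Rightarrow> 'n weyl \<Rightarrow> complex"
  where "Tr k a = tau (\<lambda>i. tw (k i)) (symb a)"

lemma Tr_add: "Tr k (a + b) = Tr k a + Tr k b"
  and Tr_scale: "Tr k (scaleA c a) = c * Tr k a"
  by (simp_all add: Tr_def symb_simps tau_add tau_scale)

text \<open>For a generator, left and right multiplication differ on symbols by a derivative, which
  integration by parts turns into \<open>chi (k i) - 1\<close> times multiplication by the variable.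
  A product is moved around one generator at a time, hence the induction over arbitrary
  \<open>a\<close>.\<close>

lemma Tr_twisted:
  assumes "\<And>i. k i \<noteq> 0"
  shows "Tr k (b * a) = Tr k (a * actA k b)"
proof (induction b arbitrary: a rule: weyl_induct)
  case (var g b)
  let ?t = "\<lambda>i. tw (k i)"
  have t: "?t i \<noteq> 0" and *: "1 / ?t i = chi (k i) - 1" for i using assms[of i] by (simp_all add: tw_def)
  have **: "tau ?t (pdiff (Y i) f) = (chi (k i) - 1) * tau ?t (pv (X i) * f)"
    "tau ?t (pdiff (X i) f) = (chi (k i) - 1) * tau ?t (pv (Y i) * f)" for i f
    using t[of i] unfolding tau_pdiff *[symmetric] by simp_all
  have g: "Tr k (wv g * a) = Tr k (a * actA k (wv g))" for a
    by (cases g) (simp_all add: Tr_def symb_simps actA_wv scaleA_mult_right symb_mult_P symb_mult_Q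
        tau_add tau_scale ** algebra_simps)
  have "Tr k (wv g * b * a) = Tr k (b * (a * actA k (wv g)))"
    using g[of "b * a"] by (simp add: mult.assoc)
  also have "\<dots> = Tr k (a * actA k (wv g * b))"
    by (simp add: var actA_algebra_hom mult.assoc)
  finally show ?case .
qed (simp_all add: actA_algebra_hom distrib_left distrib_right Tr_add Tr_scale scaleA_mult_left scaleA_mult_right)

lemma Tr_commutator:
  assumes "k \<in> grp" "\<And>i. k i \<noteq> 0" "b \<in> invA"
  shows "Tr k (commutator b a) = 0"
proof -
  have "Tr k (b * a) = Tr k (a * b)"
    using Tr_twisted[of k b a, OF assms(2)] assms(1,3) by (simp add: invA_def)
  moreover have "b * a = commutator b a + a * b" by (simp add: commutator_def)
  ultimately show ?thesis by (metis Tr_add add_cancel_left_left)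
qed


subsection \<open>Relations in the commutator quotient\<close>

text \<open>The commutator span transported to symbols, so that relations are computed with
  commutative polynomials.\<close>

definition nspan :: "'n::finite cpol set"
  where "nspan = {f. normal f \<in> commutator_span}"

lemma subspace_nspan: "cpoly.subspace nspan"
  unfolding cpoly.subspace_def nspan_def
  by (auto simp: normal_add normal_scale HH0_closed)

lemmas nspan_closed = cpoly.subspace_0[OF subspace_nspan] cpoly.subspace_add[OF subspace_nspan]
  cpoly.subspace_diff[OF subspace_nspan] cpoly.subspace_scale[OF subspace_nspan]

lemma nspan_scale_iff: "c \<noteq> 0 \<Longrightarrow> scaleP c f \<in> nspan \<longleftrightarrow> f \<in> nspan"
  using nspan_closed(4)[of "scaleP c f" "inverse c"] nspan_closed(4)[of f c] by auto

lemma commutator_in_span: "a \<in> invA \<Longrightarrow> b \<in> invA \<Longrightarrow> commutator a b \<in> commutator_span"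
  unfolding commutator_span_def by (intro weyl.span_base) blast

lemma commutator_in_nspan:
  assumes "f \<in> invS" "g \<in> invS"
    and "normal f * normal g = normal u" "normal g * normal f = normal v"
  shows "u - v \<in> nspan"
proof -
  have "normal (u - v) + normal v = normal u"
    by (simp flip: normal_add)
  then have "normal (u - v) = commutator (normal f) (normal g)"
    using assms by (simp add: commutator_def eq_diff_eq)
  then show ?thesis
    using assms by (simp add: nspan_def commutator_in_span normal_in_invA)
qed

text \<open>For \<open>zz i\<close> the symbol of the commutator is exactly the Poisson bracket: the
  leading products cancel and no higher derivatives arise. The weight argument thus carries
  over.\<close>

lemma poisson_zz_in_nspan:
  assumes "f \<in> invS"
  shows "poisson (zz i) f \<in> nspan"
proof -
  have z: "normal (zz i) = wv (Q i) * wv (P i)"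
    using normal_var[of "Y i" "pv (X i)"] by (simp add: normal_pv mult.commute)
  have "normal (zz i) * normal f = normal (pv (Y i) * (pv (X i) * f + pdiff (Y i) f))"
    by (simp only: z mult.assoc normal_mult_P_left normal_mult_Q_left)
  moreover have "normal f * normal (zz i) = normal (pv (X i) * (pv (Y i) * f + pdiff (X i) f))"
    by (simp only: z mult.assoc[symmetric] normal_mult_P_right normal_mult_Q_right)
  ultimately have "pv (Y i) * (pv (X i) * f + pdiff (Y i) f) - pv (X i) * (pv (Y i) * f + pdiff (X i) f) \<in> nspan"
    by (rule commutator_in_nspan[OF invS_zz assms])
  then show ?thesis by (simp add: poisson_zz algebra_simps)
qed

lemma mon_in_nspan:
  assumes "mon m \<in> invS" "weight m i \<noteq> 0"
  shows "mon m \<in> nspan"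
  using poisson_zz_in_nspan[OF assms(1), of i] assms(2)
  by (simp add: poisson_zz_mon nspan_scale_iff del: cpoly.scale_minus_left)

text \<open>On symbols, left multiplication by the cube of \<open>P i\<close> is the cube of
  \<open>pv (X i) + pdiff (Y i)\<close>, right multiplication is the cube of
  \<open>pv (X i)\<close>. The two summands commute, so the difference is a binomial expansion
  without its leading term.\<close>

lemma cube_in_nspan:
  assumes "f \<in> invS"
  shows "3 * pv (X i) ^ 2 * pdiff (Y i) f + 3 * pv (X i) * pdiff (Y i) (pdiff (Y i) f)
    + pdiff (Y i) (pdiff (Y i) (pdiff (Y i) f)) \<in> nspan"
proof -
  let ?D = "\<lambda>f. pv (X i) * f + pdiff (Y i) f"
  have z: "normal (pv (X i) ^ 3) = wv (P i) * wv (P i) * wv (P i)"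
    by (simp add: power3_eq_cube normal_var normal_pv mult.assoc)
  have "normal (pv (X i) ^ 3) * normal f = normal (?D (?D (?D f)))"
    by (simp only: z mult.assoc normal_mult_P_left)
  moreover have "normal f * normal (pv (X i) ^ 3) = normal (pv (X i) * (pv (X i) * (pv (X i) * f)))"
    by (simp only: z mult.assoc[symmetric] normal_mult_P_right)
  ultimately have "?D (?D (?D f)) - pv (X i) * (pv (X i) * (pv (X i) * f)) \<in> nspan"
    by (rule commutator_in_nspan[OF invS_cubes(1) assms])
  moreover have "?D (?D (?D f)) - pv (X i) * (pv (X i) * (pv (X i) * f)) =
    3 * pv (X i) ^ 2 * pdiff (Y i) f + 3 * pv (X i) * pdiff (Y i) (pdiff (Y i) f)
    + pdiff (Y i) (pdiff (Y i) (pdiff (Y i) f))"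
    by (simp add: pdiff_add pdiff_mult pdiff_pv algebra_simps power2_eq_square)
  ultimately show ?thesis by simp
qed

text \<open>As \<open>tau\<close> sends the square of \<open>zz i\<close> to twice the square of
  \<open>t i\<close>, this polynomial is sent to 2(3t^2 + 3t + 1) with t = \<open>t i\<close>, which
  is zero at the values of \<open>tw\<close> by \<open>tw_root\<close>.\<close>

definition cube_rel :: "'n \<Rightarrow> 'n cpol"
  where "cube_rel i = 3 * zz i ^ 2 + 6 * zz i + 2"

text \<open>Take \<open>f\<close> to be the cube of \<open>pv (Y i)\<close> times \<open>M\<close>
  in \<open>cube_in_nspan\<close>; with z = \<open>zz i\<close> the result is (9z^2 + 18z + 6)
  M.\<close>

lemma cube_rel_in_nspan:
  assumes M: "M \<in> invS" "pdiff (Y i) M = 0"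
  shows "cube_rel i * M \<in> nspan"
proof -
  have d: "pdiff (Y i) (pv (Y i) ^ 3 * M) = 3 * pv (Y i) ^ 2 * M"
    "pdiff (Y i) (3 * pv (Y i) ^ 2 * M) = 6 * pv (Y i) * M"
    "pdiff (Y i) (6 * pv (Y i) * M) = 6 * M"
    by (simp_all add: pdiff_mult pdiff_power pdiff_pv M(2))
  have "pv (Y i) ^ 3 * M \<in> invS" by (intro invS_mult invS_cubes M)
  from cube_in_nspan[OF this, of i] have "scaleP 3 (cube_rel i * M) \<in> nspan"
    unfolding d by (simp add: cube_rel_def algebra_simps power2_eq_square flip: numeral_mult_scaleP)
  then show ?thesis by (simp add: nspan_scale_iff)
qed

text \<open>Since \<open>cube_rel_in_nspan\<close> only allows factors constant in
  \<open>Y i\<close>, higher powers of \<open>zz i\<close> need their own recursion. It comes from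
  \<open>cube_in_nspan\<close> at \<open>cube_partner\<close>, after cancelling
  \<open>a + 3\<close>.\<close>

lemma zmon_reduce:
  fixes s :: "'n::finite \<Rightarrow> nat"
  assumes "s i = a + 2"
  shows "scaleP 3 (zmon s) + scaleP (of_nat (3 * (a + 2))) (zmon (s(i := a + 1)))
    + scaleP (of_nat ((a + 2) * (a + 1))) (zmon (s(i := a))) \<in> nspan"
proof -
  let ?R = "\<Prod>j\<in>UNIV - {i}. zz j ^ s j"
  let ?g = "\<lambda>b. pv (X i) ^ a * pv (Y i) ^ b * ?R"
  have d: "pdiff (Y i) (?g c) = of_nat c * ?g b" if "c = b + 1" for b c
  proof -
    have "pdiff (Y i) (pv (X i) ^ a) = 0" "pdiff (Y i) (pv (Y i) ^ c) = of_nat c * pv (Y i) ^ b"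
      by (simp_all only: pdiff_power pdiff_pv that) simp_all
    then show ?thesis
      by (simp only: pdiff_mult pdiff_zmon_rest) (simp add: mult_ac)
  qed
  have d': "pdiff (Y i) (of_nat n * f) = of_nat n * pdiff (Y i) f" for n f
    by (simp add: pdiff_mult)
  have R: "(\<Prod>j\<in>UNIV - {i}. zz j ^ (s(i := b)) j) = ?R" for b
    by (rule prod.cong) auto
  have z: "zmon s = zz i ^ (a + 2) * ?R" "zmon (s(i := a + 1)) = zz i ^ (a + 1) * ?R"
    "zmon (s(i := a)) = zz i ^ a * ?R"
    using zmon_split[of s i] zmon_split[of "s(i := a + 1)" i] zmon_split[of "s(i := a)" i]
    unfolding R by (simp_all only: assms fun_upd_same)
  have e1: "pdiff (Y i) (?g (a + 3)) = of_nat (a + 3) * ?g (a + 2)"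
    and "pdiff (Y i) (?g (a + 2)) = of_nat (a + 2) * ?g (a + 1)"
    and "pdiff (Y i) (?g (a + 1)) = of_nat (a + 1) * ?g a"
    by (rule d; simp)+
  then have e2: "pdiff (Y i) (of_nat (a + 3) * ?g (a + 2)) = of_nat (a + 3) * (of_nat (a + 2) * ?g (a + 1))"
    and e3: "pdiff (Y i) (of_nat (a + 3) * (of_nat (a + 2) * ?g (a + 1))) = of_nat (a + 3) * (of_nat (a + 2) * (of_nat (a + 1) * ?g a))"
    by (simp_all only: d')
  have "of_nat (a + 3) * (3 * zmon s + of_nat (3 * (a + 2)) * zmon (s(i := a + 1)) + of_nat ((a + 2) * (a + 1)) * zmon (s(i := a))) \<in> nspan"
    using cube_in_nspan[OF cube_partner(1), of i i a s]
    unfolding e1 e2 e3 z by (simp add: algebra_simps power2_eq_square power_mult_distrib power_add)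
  moreover have "of_nat (a + 3) \<noteq> (0 :: complex)"
    using of_nat_eq_0_iff[of "a + 3", where 'a = complex] by simp
  ultimately show ?thesis
    unfolding of_nat_mult_scaleP numeral_mult_scaleP using nspan_scale_iff by blast
qed

text \<open>Each \<open>P i\<close> acts on its own factor only, the other factors being constant in
  \<open>Y i\<close>.\<close>

lemma normal_prod_left:
  fixes \<phi> :: "'n::finite \<Rightarrow> 'n cpol"
  assumes "\<And>i j. i \<noteq> j \<Longrightarrow> pdiff (Y i) (\<phi> j) = 0"
  shows "normal (\<Prod>i\<in>I. pv (X i)) * normal (\<Prod>j\<in>UNIV. \<phi> j) =
    normal (\<Prod>j\<in>UNIV. if j \<in> I then pv (X j) * \<phi> j + pdiff (Y j) (\<phi> j) else \<phi> j)"
proof -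
  have "finite I" by simp
  then show ?thesis using assms
  proof (induction I arbitrary: \<phi> rule: finite_induct)
    case (insert i I)
    \<comment> \<open>One factor is updated at a time; separation of variables survives because
      partial derivatives commute.\<close>
    define \<psi> where "\<psi> = \<phi>(i := pv (X i) * \<phi> i + pdiff (Y i) (\<phi> i))"
    have *: "pdiff (Y l) (\<psi> j) = 0" if "l \<noteq> j" for l j
      using insert.prems[OF that] that
      by (auto simp: \<psi>_def pdiff_add pdiff_mult pdiff_pv pdiff_commute[of "Y l" "Y i"])
    have "pdiff (Y i) (\<Prod>j\<in>UNIV - {i}. \<phi> j) = 0"
      by (rule pdiff_prod_0) (auto intro: insert.prems)
    then have "pv (X i) * (\<Prod>j\<in>UNIV. \<phi> j) + pdiff (Y i) (\<Prod>j\<in>UNIV. \<phi> j) = \<psi> i * (\<Prod>j\<in>UNIV - {i}. \<phi> j)"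
      by (simp add: prod.remove[of UNIV i] pdiff_mult \<psi>_def algebra_simps)
    also have "(\<Prod>j\<in>UNIV - {i}. \<phi> j) = (\<Prod>j\<in>UNIV - {i}. \<psi> j)"
      by (rule prod.cong) (auto simp: \<psi>_def)
    also have "\<psi> i * (\<Prod>j\<in>UNIV - {i}. \<psi> j) = (\<Prod>j\<in>UNIV. \<psi> j)"
      by (simp add: prod.remove[of UNIV i])
    finally have "wv (P i) * normal (\<Prod>j\<in>UNIV. \<phi> j) = normal (\<Prod>j\<in>UNIV. \<psi> j)"
      by (simp add: normal_mult_P_left)
    then have "normal (\<Prod>i\<in>insert i I. pv (X i)) * normal (\<Prod>j\<in>UNIV. \<phi> j) =
        normal (\<Prod>i\<in>I. pv (X i)) * normal (\<Prod>j\<in>UNIV. \<psi> j)"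
      using insert.hyps by (simp add: normal_var mult.assoc)
    also have "\<dots> = normal (\<Prod>j\<in>UNIV. if j \<in> I then pv (X j) * \<psi> j + pdiff (Y j) (\<psi> j) else \<psi> j)"
      by (rule insert.IH) (rule *)
    also have "(\<Prod>j\<in>UNIV. if j \<in> I then pv (X j) * \<psi> j + pdiff (Y j) (\<psi> j) else \<psi> j) =
      (\<Prod>j\<in>UNIV. if j \<in> insert i I then pv (X j) * \<phi> j + pdiff (Y j) (\<phi> j) else \<phi> j)"
      using insert.hyps by (intro prod.cong) (auto simp: \<psi>_def)
    finally show ?case .
  qed simp
qed

lemma normal_prod_right: "normal f * normal (\<Prod>i\<in>I. pv (X i)) = normal ((\<Prod>i\<in>I. pv (X i)) * f)"
proof (induction I rule: infinite_finite_induct)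
  case (insert i I)
  then show ?case
    by (simp add: normal_var mult.assoc[symmetric]) (simp add: mult.assoc normal_var)
qed simp_all

lemma prod_in_nspan:
  fixes \<phi> :: "'n::finite \<Rightarrow> 'n cpol"
  assumes "\<And>i j. i \<noteq> j \<Longrightarrow> pdiff (Y i) (\<phi> j) = 0" "(\<Prod>j\<in>UNIV. \<phi> j) \<in> invS"
  shows "(\<Prod>j\<in>UNIV. pv (X j) * \<phi> j + pdiff (Y j) (\<phi> j)) - (\<Prod>j\<in>UNIV. pv (X j) * \<phi> j) \<in> nspan"
  using commutator_in_nspan[OF invS_prods(1) assms(2) normal_prod_left[OF assms(1)] normal_prod_right]
  by (simp add: prod.distrib)

text \<open>Inserting one \<open>cube_rel i\<close> changes the product by \<open>cube_rel i\<close>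
  times factors that are invariant and constant in \<open>Y i\<close>. All these summands can
  therefore be dropped modulo \<open>nspan\<close>.\<close>

lemma cube_rel_prod:
  fixes \<psi> :: "'n::finite \<Rightarrow> 'n cpol"
  assumes \<psi>: "\<And>i j. i \<noteq> j \<Longrightarrow> pdiff (Y i) (\<psi> j) = 0" "\<And>j. \<psi> j \<in> invS"
  shows "(\<Prod>j\<in>UNIV. cube_rel j + \<psi> j) - (\<Prod>j\<in>UNIV. \<psi> j) \<in> nspan"
proof -
  let ?f = "\<lambda>I j. if j \<in> I then cube_rel j + \<psi> j else \<psi> j"
  have rel: "cube_rel j \<in> invS" "i \<noteq> j \<Longrightarrow> pdiff (Y i) (cube_rel j) = 0" for i j :: 'n
  proof -
    have "3 * zz j ^ 2 \<in> invS" "6 * zz j \<in> invS" "2 * 1 \<in> (invS :: 'n cpol set)"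
      unfolding numeral_mult_scaleP by (intro HP0_closed(5) invS_power invS_zz invS_1)+
    then show "cube_rel j \<in> invS"
      by (simp add: cube_rel_def HP0_closed)
    show "pdiff (Y i) (cube_rel j) = 0" if "i \<noteq> j"
      using that by (simp add: cube_rel_def pdiff_add pdiff_mult pdiff_power pdiff_pv)
  qed
  have "(\<Prod>j\<in>UNIV. ?f I j) - (\<Prod>j\<in>UNIV. \<psi> j) \<in> nspan" if "finite I" for I
    using that
  proof (induction I rule: finite_induct)
    case (insert i I)
    have c: "(\<Prod>j\<in>UNIV - {i}. ?f (insert i I) j) = (\<Prod>j\<in>UNIV - {i}. ?f I j)"
      by (rule prod.cong) auto
    have "(\<Prod>j\<in>UNIV. ?f (insert i I) j) = (cube_rel i + \<psi> i) * (\<Prod>j\<in>UNIV - {i}. ?f I j)"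
      by (subst prod.remove[of UNIV i]) (simp_all add: c del: insert_iff, simp)
    moreover have "(\<Prod>j\<in>UNIV. ?f I j) = \<psi> i * (\<Prod>j\<in>UNIV - {i}. ?f I j)"
      using insert.hyps by (subst prod.remove[of UNIV i]) simp_all
    moreover have "cube_rel i * (\<Prod>j\<in>UNIV - {i}. ?f I j) \<in> nspan"
      by (intro cube_rel_in_nspan invS_prod pdiff_prod_0) (auto simp: pdiff_add rel \<psi> HP0_closed)
    ultimately have "(\<Prod>j\<in>UNIV. ?f (insert i I) j) - (\<Prod>j\<in>UNIV. ?f I j) \<in> nspan"
      by (simp add: algebra_simps)
    from nspan_closed(2)[OF this insert.IH] show ?case by simp
  qed (simp add: nspan_closed)
  from this[of UNIV] show ?thesis by simp
qed


subsection \<open>A dual basis for the twisted traces\<close>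

text \<open>The two roots of 3t^2 + 3t + 1 add up to -1, so for nonzero \<open>k i\<close> the i-th
  factor is \<open>zz i\<close> minus the root other than \<open>tw (k i)\<close>.\<close>

definition ehat :: "('n::finite \<Rightarrow> 3) \<Rightarrow> 'n cpol"
  where "ehat k = (\<Prod>i\<in>UNIV. zz i + scaleP (1 + tw (k i)) 1)"

text \<open>With u = \<open>chi a - 1\<close> the equation
  \<open>(chi a)\<^sup>2 + chi a + 1 = 0\<close> reads u^2 + 3u + 3 = 0; its reciprocal form is
  satisfied by 1/u.\<close>

lemma tw_root: "3 * (tw a * tw a) + 3 * tw a + 1 = 0" if "a \<noteq> 0"
proof -
  have "chi a - 1 \<noteq> 0" using that by simp
  then have "(chi a - 1) * tw a = 1" by (simp add: tw_def)
  moreover have "(chi a)\<^sup>2 + chi a + 1 = 0" using chi_primitive[OF that] .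
  ultimately have "((chi a - 1) * tw a)\<^sup>2 * 3 + ((chi a - 1) * tw a) * (chi a - 1) * 3 + (chi a - 1)\<^sup>2 = (chi a)\<^sup>2 + chi a + 1"
    by (simp add: power2_eq_square algebra_simps)
  also have "\<dots> = 0" by fact
  finally have "(chi a - 1)\<^sup>2 * (3 * (tw a * tw a) + 3 * tw a + 1) = 0"
    by (simp add: power2_eq_square algebra_simps)
  then show ?thesis using \<open>chi a - 1 \<noteq> 0\<close> by simp
qed

lemma tw_nonzero: "a \<noteq> 0 \<Longrightarrow> tw a \<noteq> 0"
  by (simp add: tw_def)

lemma tw_chi: "1 + tw a = tw a * chi a" if "a \<noteq> 0"
proof -
  have "chi a - 1 \<noteq> 0" using that by simp
  then have "tw a * (chi a - 1) = 1" by (simp add: tw_def)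
  then show ?thesis by (simp add: algebra_simps)
qed

lemma tw_inject: "tw a = tw b \<longleftrightarrow> a = b" if "a \<noteq> 0" "b \<noteq> 0"
proof
  assume "tw a = tw b"
  then have "tw a * chi a = tw a * chi b" using tw_chi that by metis
  then have "chi a = chi b" using tw_nonzero that by simp
  moreover have "chi a = chi (a - b) * chi b" by (simp flip: chi_add)
  ultimately have "chi (a - b) = 1" by simp
  then show "a = b" by (simp only: chi_eq_1_iff right_minus_eq)
qed simp

text \<open>For \<open>a = b\<close>, vanishing would mean a double root, which completing the
  square excludes. For \<open>a \<noteq> b\<close>, subtracting the two quadratic equations leaves a
  product whose first factor is nonzero.\<close>

lemma tw_dual: "tw a + (1 + tw b) \<noteq> 0 \<longleftrightarrow> a = b" if "a \<noteq> 0" "b \<noteq> 0"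
proof (cases "a = b")
  case True
  have "tw a + (1 + tw a) \<noteq> 0"
  proof
    assume "tw a + (1 + tw a) = 0"
    moreover have "3 * (tw a + (1 + tw a))\<^sup>2 + 1 = 4 * (3 * (tw a * tw a) + 3 * tw a + 1)"
      by (simp add: power2_eq_square algebra_simps)
    ultimately show False using tw_root[OF that(1)] by simp
  qed
  then show ?thesis using True by simp
next
  case False
  have "(tw a - tw b) * (tw a + (1 + tw b)) = 0"
    using tw_root[OF that(1)] tw_root[OF that(2)] by algebra
  then show ?thesis using False tw_inject[OF that] by simp
qed

text \<open>The commutator of the product of all \<open>P i\<close> with the product of the
  \<open>\<phi> i\<close> equals, modulo \<open>nspan\<close>, the product of the
  \<open>6 * (1 + ?t i)\<close> minus that of the \<open>6 * ?t i\<close>, times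
  \<open>ehat k\<close>. By \<open>tw_chi\<close> the two products differ by the factor
  \<open>chi (\<Sum>i. k i)\<close>, which is not 1.\<close>

lemma ehat_in_nspan:
  fixes k :: "'n::finite \<Rightarrow> 3"
  assumes k: "\<And>i. k i \<noteq> 0" and sum: "(\<Sum>i\<in>UNIV. k i) \<noteq> 0"
  shows "ehat k \<in> nspan"
proof -
  let ?t = "\<lambda>i. tw (k i)"
  let ?E = "\<lambda>i. zz i + scaleP (1 + ?t i) 1"
  \<comment> \<open>Chosen so that \<open>pdiff (Y i) (\<phi> i)\<close> is 6 times
    \<open>?E i\<close>, and \<open>pv (X i) * \<phi> i\<close> equals \<open>cube_rel i\<close>
    plus \<open>6 * ?t i\<close> times \<open>?E i\<close> by the quadratic equation for
    \<open>?t i\<close>.\<close>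
  define \<phi> where "\<phi> i = (3 * zz i + scaleP (6 + 6 * ?t i) 1) * pv (Y i)" for i
  have inv: "3 * zz i + scaleP c 1 \<in> invS" "zz i + scaleP c 1 \<in> invS" for i :: 'n and c
    unfolding numeral_mult_scaleP by (intro HP0_closed invS_zz invS_1)+
  have A: "pv (X i) * \<phi> i + pdiff (Y i) (\<phi> i) = cube_rel i + scaleP (6 * (1 + ?t i)) (?E i)"
    and B: "pv (X i) * \<phi> i = cube_rel i + scaleP (6 * ?t i) (?E i)" for i
  proof -
    \<comment> \<open>The scalar becomes a constant polynomial, so that ring normalisation
      applies.\<close>
    define T where "T = scaleP (?t i) (1 :: 'n cpol)"
    have c: "scaleP (numeral n) 1 = (numeral n :: 'n cpol)" for n
      using numeral_mult_scaleP[of n "1 :: 'n cpol"] by simp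
    have m: "scaleP (a * b) 1 = scaleP a 1 * scaleP b (1 :: 'n cpol)" for a b
      by (simp add: scaleP_mult_left)
    have s: "scaleP a f = scaleP a 1 * f" for a and f :: "'n cpol"
      by (simp add: scaleP_mult_left)
    have T: "scaleP (6 + 6 * ?t i) 1 = 6 + 6 * T" "scaleP (6 * (1 + ?t i)) 1 = 6 * (1 + T)"
      "scaleP (1 + ?t i) 1 = 1 + T" "scaleP (6 * ?t i) 1 = 6 * T"
      by (simp_all only: cpoly.scale_left_distrib cpoly.scale_one m c T_def)
    have "scaleP (3 * (?t i * ?t i) + 3 * ?t i + 1) (1 :: 'n cpol) = 0"
      by (simp only: tw_root[OF k] cpoly.scale_zero_left)
    then have root: "3 * (T * T) + 3 * T + 1 = 0"
      by (simp only: cpoly.scale_left_distrib cpoly.scale_one m c T_def)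
    have dT: "pdiff v T = 0" for v by (simp add: T_def pdiff_scale)
    have p: "\<phi> i = (3 * zz i + (6 + 6 * T)) * pv (Y i)"
      by (simp only: \<phi>_def T)
    have "cube_rel i + 6 * (1 + T) * (zz i + (1 + T)) =
        pv (X i) * \<phi> i + pdiff (Y i) (\<phi> i) + 2 * (3 * (T * T) + 3 * T + 1)"
      by (simp add: p cube_rel_def pdiff_mult pdiff_add pdiff_pv dT power2_eq_square algebra_simps)
    then show "pv (X i) * \<phi> i + pdiff (Y i) (\<phi> i) = cube_rel i + scaleP (6 * (1 + ?t i)) (?E i)"
      unfolding root s[of _ "?E i"] unfolding T by simp
    have "cube_rel i + 6 * T * (zz i + (1 + T)) = pv (X i) * \<phi> i + 2 * (3 * (T * T) + 3 * T + 1)"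
      by (simp add: p cube_rel_def power2_eq_square algebra_simps)
    then show "pv (X i) * \<phi> i = cube_rel i + scaleP (6 * ?t i) (?E i)"
      unfolding root s[of _ "?E i"] unfolding T by simp
  qed
  have d: "pdiff (Y i) (\<phi> j) = 0" "pdiff (Y i) (scaleP c (?E j)) = 0" if "i \<noteq> j" for i j c
    using that by (simp_all add: \<phi>_def pdiff_mult pdiff_add pdiff_scale pdiff_pv)
  have "(\<Prod>j\<in>UNIV. \<phi> j) \<in> invS"
    unfolding \<phi>_def prod.distrib by (intro invS_mult invS_prods invS_prod inv)
  from prod_in_nspan[OF d(1) this]
  have 1: "(\<Prod>j\<in>UNIV. cube_rel j + scaleP (6 * (1 + ?t j)) (?E j)) - (\<Prod>j\<in>UNIV. cube_rel j + scaleP (6 * ?t j) (?E j)) \<in> nspan"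
    unfolding A unfolding B by simp
  have 2: "(\<Prod>j\<in>UNIV. cube_rel j + scaleP (c j) (?E j)) - scaleP (\<Prod>j\<in>UNIV. c j) (ehat k) \<in> nspan" for c
    using cube_rel_prod[of "\<lambda>j. scaleP (c j) (?E j)"] d(2) HP0_closed(5)[OF inv(2)]
    by (simp add: scaleP_prod ehat_def)
  let ?a = "\<Prod>j\<in>UNIV. 6 * (1 + ?t j)" and ?b = "\<Prod>j\<in>UNIV. 6 * ?t j"
  have "scaleP (?a - ?b) (ehat k) \<in> nspan"
    using nspan_closed(2)[OF nspan_closed(3)[OF 1 2[of "\<lambda>j. 6 * (1 + ?t j)"]] 2[of "\<lambda>j. 6 * ?t j"]]
    by (simp add: cpoly.scale_left_diff_distrib algebra_simps)
  moreover have "?a - ?b \<noteq> 0"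
  proof -
    have "?a = ?b * chi (\<Sum>i\<in>UNIV. k i)"
      by (simp add: tw_chi[OF k] chi_sum prod.distrib)
    then have "?a - ?b = ?b * (chi (\<Sum>i\<in>UNIV. k i) - 1)"
      by (simp add: algebra_simps)
    moreover have "?b \<noteq> 0" using tw_nonzero[OF k] by simp
    ultimately show ?thesis using sum by simp
  qed
  ultimately show ?thesis by (simp add: nspan_scale_iff)
qed

text \<open>Integration by parts peels off one pair at a time, since the remaining factors are
  constant in \<open>Y i\<close>.\<close>

lemma tau_ehat: "tau t (ehat k) = (\<Prod>i\<in>UNIV. t i + (1 + tw (k i)))"
proof -
  let ?E = "\<lambda>i. zz i + scaleP (1 + tw (k i)) 1"
  have "tau t (\<Prod>i\<in>I. ?E i) = (\<Prod>i\<in>I. t i + (1 + tw (k i)))" if "finite I" for I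
    using that
  proof (induction I rule: finite_induct)
    case empty
    show ?case using tau_mon[of t 0] by (simp add: weight_def)
  next
    case (insert i I)
    let ?M = "\<Prod>i\<in>I. ?E i"
    have "pdiff (Y i) ?M = 0"
      using insert.hyps by (intro pdiff_prod_0) (auto simp: pdiff_add pdiff_mult pdiff_pv pdiff_scale)
    then have "tau t (pv (X i) * (pv (Y i) * ?M)) = t i * tau t ?M"
      by (simp add: tau_pdiff(1) pdiff_mult pdiff_pv)
    then show ?case
      using insert by (simp add: distrib_right tau_add tau_scale scaleP_mult_left mult.assoc)
  qed
  then show ?thesis by (simp add: ehat_def)
qed

text \<open>The group elements without eigenvalue 1 on the span of the generators.\<close>

definition traces :: "('n::finite \<Rightarrow> 3) set"
  where "traces = {k \<in> grp. \<forall>i. k i \<noteq> 0}"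

lemma ehat_in_invS: "ehat k \<in> invS"
  unfolding ehat_def by (intro invS_prod HP0_closed invS_zz invS_1)

text \<open>Exponents of at least 2 are lowered by \<open>zmon_reduce\<close>. In a squarefree
  product every factor is 1 or \<open>zz i\<close>, a combination of the two linear factors
  belonging to residues 1 and 2; multiplying out gives the \<open>ehat k\<close>, and those with
  nonzero sum of entries lie in \<open>nspan\<close>.\<close>

lemma zmon_in_span: "zmon s \<in> cpoly.span (nspan \<union> ehat ` traces)" (is "_ \<in> ?S")
proof (induction "sum s UNIV" arbitrary: s rule: less_induct)
  case less
  show ?case
  proof (cases "\<exists>i. s i \<ge> 2")
    case True
    then obtain i a where i: "s i = a + 2" by (metis add.commute le_Suc_ex)
    have lt: "sum (s(i := b)) UNIV < sum s UNIV" if "b < s i" for b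
      using that by (intro sum_strict_mono_ex1) auto
    define r where "r = scaleP (of_nat (3 * (a + 2))) (zmon (s(i := a + 1)))
      + scaleP (of_nat ((a + 2) * (a + 1))) (zmon (s(i := a)))"
    have r: "r \<in> ?S"
      unfolding r_def by (intro cpoly.span_add cpoly.span_scale less lt) (simp_all add: i)
    have "scaleP 3 (zmon s) + r \<in> ?S"
      using zmon_reduce[of s i a, OF i] by (intro cpoly.span_base) (simp add: r_def add.assoc)
    from cpoly.span_scale[OF cpoly.span_diff[OF this r], of "1 / 3"] show ?thesis by simp
  next
    case False
    have ehat: "ehat k \<in> ?S" if "k \<in> PiE UNIV (\<lambda>_. {1, 2})" for k
    proof -
      have k: "k i \<noteq> 0" for i
        using PiE_mem[OF that, of i] by auto
      show ?thesis
      proof (cases "(\<Sum>i\<in>UNIV. k i) = 0")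
        case True
        then have "k \<in> traces" using k by (simp add: traces_def grp_def)
        then show ?thesis by (intro cpoly.span_base) blast
      qed (use ehat_in_nspan[of k] k in \<open>auto intro: cpoly.span_base\<close>)
    qed
    let ?E = "\<lambda>i a. zz i + scaleP (1 + tw a) 1"
    have "\<exists>c. zz i ^ s i = (\<Sum>a\<in>{1, 2}. scaleP (c a) (?E i a))" for i
    proof -
      let ?d = "tw 1 - tw 2"
      \<comment> \<open>\<open>q\<close> inverts the determinant of the 2 by 2 system for the
        coefficients. The solution is \<open>q\<close>, \<open>- q\<close> for the constant 1, and
        \<open>- (1 + tw 2) * q\<close>, \<open>(1 + tw 1) * q\<close> for
        \<open>zz i\<close>.\<close>
      define q where "q = 1 / ?d"
      have q: "q * ?d = 1" using tw_inject[of 1 2] by (simp add: q_def)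
      have *: "(\<Sum>a\<in>{1, 2}. scaleP (c a) (?E i a)) =
          scaleP (c 1 + c 2) (zz i) + scaleP (c 1 * (1 + tw 1) + c 2 * (1 + tw 2)) 1" for c
      proof -
        have "(\<Sum>a\<in>{1, 2}. scaleP (c a) (?E i a)) = scaleP (c 1) (?E i 1) + scaleP (c 2) (?E i 2)"
          by simp
        moreover have "scaleP x (zz i + scaleP d 1) + scaleP y (zz i + scaleP e 1) =
            scaleP (x + y) (zz i) + scaleP (x * d + y * e) 1" for x y d e
          by (simp add: cpoly.scale_right_distrib cpoly.scale_left_distrib add_ac)
        ultimately show ?thesis by (simp only:)
      qed
      show ?thesis
      proof (cases "s i = 0")
        case True
        have "q * (1 + tw 1) + - q * (1 + tw 2) = 1"
          using q by algebra
        then show ?thesis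
          unfolding * using True by (intro exI[of _ "\<lambda>a. if a = 1 then q else - q"]) simp
      next
        case False
        then have "s i = 1" using \<open>\<not> (\<exists>i. s i \<ge> 2)\<close> by (metis One_nat_def less_2_cases not_le)
        moreover have "- (1 + tw 2) * q + (1 + tw 1) * q = 1"
          using q by algebra
        moreover have "- (1 + tw 2) * q * (1 + tw 1) + (1 + tw 1) * q * (1 + tw 2) = 0"
          by (simp add: algebra_simps)
        ultimately show ?thesis
          unfolding * by (intro exI[of _ "\<lambda>a. if a = 1 then - (1 + tw 2) * q else (1 + tw 1) * q"]) simp
      qed
    qed
    then have "\<exists>c. \<forall>i. zz i ^ s i = (\<Sum>a\<in>{1, 2}. scaleP (c i a) (?E i a))"
      by (intro choice allI)
    then obtain c where c: "\<And>i. zz i ^ s i = (\<Sum>a\<in>{1, 2}. scaleP (c i a) (?E i a))"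
      by blast
    have "zmon s = (\<Prod>i\<in>UNIV. \<Sum>a\<in>{1, 2}. scaleP (c i a) (?E i a))"
      unfolding zmon_def c ..
    also have "\<dots> = (\<Sum>k\<in>PiE UNIV (\<lambda>_. {1, 2}). \<Prod>i\<in>UNIV. scaleP (c i (k i)) (?E i (k i)))"
      by (rule prod_sum_PiE) auto
    also have "\<dots> = (\<Sum>k\<in>PiE UNIV (\<lambda>_. {1, 2}). scaleP (\<Prod>i\<in>UNIV. c i (k i)) (ehat k))"
      by (simp add: scaleP_prod ehat_def)
    also have "\<dots> \<in> ?S"
      by (intro cpoly.span_sum cpoly.span_scale ehat)
    finally show ?thesis .
  qed
qed

lemma invS_subset_span: "(invS :: 'n::finite cpol set) \<subseteq> cpoly.span (nspan \<union> ehat ` traces)" (is "_ \<subseteq> ?S")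
proof
  fix f :: "'n cpol"
  assume "f \<in> invS"
  then show "f \<in> ?S"
  proof (induction f rule: invS_induct)
    case (mon m)
    show ?case
    proof (cases "\<exists>i. weight m i \<noteq> 0")
      case True
      then show ?thesis using mon_in_nspan[OF mon] by (auto intro: cpoly.span_base)
    next
      case False
      then have "mon m = zmon (\<lambda>i. Poly_Mapping.lookup m (X i))"
        by (intro mon_weight_0) auto
      then show ?thesis using zmon_in_span by metis
    qed
  qed (auto intro: cpoly.span_add cpoly.span_scale)
qed

lemma commutator_span_subset: "commutator_span \<subseteq> invA"
  unfolding commutator_span_def
proof (rule weyl.span_minimal[OF _ subspace_invA])
  have "actA k (a - b) = actA k a - actA k b" for k :: "'a \<Rightarrow> 3" and a b
    using actA_algebra_hom(1)[of k "a - b" b] by (simp add: eq_diff_eq)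
  then show "{commutator a b |a b. a \<in> invA \<and> b \<in> invA} \<subseteq> (invA :: 'a weyl set)"
    by (auto simp: invA_def commutator_def actA_algebra_hom)
qed

section \<open>Dimension of the commutator quotient and the number of twisted traces\<close>

lemma dim_HH0_UNIV: "HH0.dim (UNIV :: 'n::finite HH0 set) = card (traces :: ('n \<Rightarrow> 3) set)"
proof (rule dim_HH0[of traces "\<lambda>k. normal (ehat k)" Tr, OF _ _ Tr_add Tr_scale _ _ commutator_span_subset])
  show "Tr k v = 0" if "k \<in> traces" "v \<in> commutator_span" for k :: "'n \<Rightarrow> 3" and v
    using that(2) unfolding commutator_span_def
  proof (induction rule: weyl.span_induct_alt)
    case base
    show ?case using Tr_scale[of k 0 0] by simp
  next
    case (step c x y)
    then obtain a b where "x = commutator a b" "a \<in> invA" "b \<in> invA" by blast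
    then show ?case using step that(1) by (simp add: Tr_add Tr_scale Tr_commutator traces_def)
  qed
  show "(Tr j (normal (ehat k)) \<noteq> 0) = (j = k)" if "j \<in> traces" "k \<in> traces" for j k :: "'n \<Rightarrow> 3"
  proof -
    have "Tr j (normal (ehat k)) \<noteq> 0 \<longleftrightarrow> (\<forall>i. tw (j i) + (1 + tw (k i)) \<noteq> 0)"
      by (simp add: Tr_def tau_ehat)
    also have "\<dots> \<longleftrightarrow> (\<forall>i. j i = k i)"
      using that tw_dual by (simp add: traces_def)
    finally show ?thesis by (simp add: fun_eq_iff)
  qed
  show "(invA :: 'n weyl set) \<subseteq> weyl.span (commutator_span \<union> (\<lambda>k. normal (ehat k)) ` traces)" (is "_ \<subseteq> ?S")
  proof
    fix a :: "'n weyl"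
    assume "a \<in> invA"
    then have "symb a \<in> invS" using normal_in_invA[of "symb a"] by simp
    then have "symb a \<in> cpoly.span (nspan \<union> ehat ` traces)" using invS_subset_span by blast
    then have "normal (symb a) \<in> ?S"
    proof (induction rule: cpoly.span_induct_alt)
      case (step c f g)
      then have "normal f \<in> ?S"
        by (intro weyl.span_base) (auto simp: nspan_def)
      then show ?case using step by (simp add: normal_add normal_scale weyl.span_add weyl.span_scale)
    qed (simp add: weyl.span_zero)
    then show "a \<in> ?S" by simp
  qed
qed (simp_all add: normal_in_invA ehat_in_invS)

text \<open>Character orthogonality: three times the indicator of a zero sum is the sum over
  \<open>a\<close> of \<open>chi (a * (\<Sum>i. k i))\<close>. After exchanging sums this factors
  over the coordinates, each contributing 2 for \<open>a = 0\<close> and -1 for the two other values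
  of \<open>a\<close>.\<close>

lemma card_traces: "3 * int (card (traces :: ('n::finite \<Rightarrow> 3) set)) = 2 ^ CARD('n) + 2 * (- 1) ^ CARD('n)"
proof -
  let ?A = "PiE UNIV (\<lambda>_. {1, 2}) :: ('n \<Rightarrow> 3) set"
  have n0: "a \<noteq> 0 \<longleftrightarrow> a \<in> {1, 2}" for a :: 3
    using UNIV_3 by auto
  have fin: "finite ?A" by simp
  have tr: "traces = {k \<in> ?A. (\<Sum>i\<in>UNIV. k i) = 0}"
    unfolding traces_def grp_def by (auto simp: n0 simp del: insert_iff)
  have 12: "chi 1 + chi 2 = - 1"
    using chi_primitive[of 1] unfolding eq_neg_iff_add_eq_0 by (simp add: chi_1 chi_2 add_ac)
  have orth: "(\<Sum>a\<in>UNIV. chi (a * c)) = (if c = 0 then 3 else 0)" for c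
  proof -
    have "c = 0 \<or> c = 1 \<or> c = 2" using UNIV_3 by auto
    \<comment> \<open>The product of residues 2 and 2 is evaluated to the numeral 4, which has to be
      identified with 1.\<close>
    moreover have 4: "(4 :: 3) = 1" by simp
    ultimately show ?thesis using 12 unfolding UNIV_3 by (auto simp: 4 add_ac)
  qed
  have row: "(\<Sum>b\<in>{1, 2}. chi (a * b)) = (if a = 0 then 2 else - 1)" for a
  proof -
    have "a = 0 \<or> a = 1 \<or> a = 2" using UNIV_3 by auto
    moreover have 4: "(4 :: 3) = 1" by simp
    ultimately show ?thesis using 12 by (auto simp: 4 add_ac)
  qed
  have "3 * of_nat (card (traces :: ('n \<Rightarrow> 3) set)) = (\<Sum>k\<in>?A. if (\<Sum>i\<in>UNIV. k i) = 0 then 3 else (0 :: complex))"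
    unfolding tr using fin by (simp add: sum.If_cases Int_def)
  also have "\<dots> = (\<Sum>k\<in>?A. \<Sum>a\<in>UNIV. chi (a * (\<Sum>i\<in>UNIV. k i)))"
    by (simp only: orth)
  also have "\<dots> = (\<Sum>a\<in>UNIV. \<Sum>k\<in>?A. \<Prod>i\<in>UNIV. chi (a * k i))"
    by (subst sum.swap) (simp add: sum_distrib_left chi_sum)
  also have "\<dots> = (\<Sum>a\<in>UNIV. \<Prod>i\<in>(UNIV :: 'n set). \<Sum>b\<in>{1, 2}. chi (a * b))"
    by (intro sum.cong refl prod_sum_PiE[symmetric]) auto
  also have "\<dots> = (\<Sum>a\<in>(UNIV :: 3 set). (if a = 0 then 2 else - 1) ^ CARD('n))"
    unfolding row by simp
  also have "\<dots> = 2 ^ CARD('n) + 2 * (- 1) ^ CARD('n)"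
    unfolding UNIV_3 by simp
  finally have "of_int (3 * int (card (traces :: ('n \<Rightarrow> 3) set))) = (of_int (2 ^ CARD('n) + 2 * (- 1) ^ CARD('n)) :: complex)"
    by simp
  then show ?thesis by (simp only: of_int_eq_iff)
qed

theorem mainTheorem7:
  assumes "CARD('n::finite) \<ge> 2"
  shows "int (HP0.dim (UNIV :: 'n HP0 set)) = 2 ^ CARD('n) - 2
    \<and> rat_of_nat (HH0.dim (UNIV :: 'n HH0 set)) =
      2 / 3 * (2 ^ (CARD('n) - 1) - (- 1) ^ (CARD('n) - 1))"
proof
  show "int (HP0.dim (UNIV :: 'n HP0 set)) = 2 ^ CARD('n) - 2"
    by (rule dim_HP0_UNIV)
  \<comment> \<open>The successor form resolves the truncated exponent; pulling out one factor 2 and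
    one sign turns (2^n + 2 (-1)^n) / 3 into the stated expression.\<close>
  obtain m where m: "CARD('n) = Suc m"
    using assms by (metis Suc_le_D numeral_2_eq_2)
  have "of_int (3 * int (card (traces :: ('n \<Rightarrow> 3) set))) = (of_int (2 ^ CARD('n) + 2 * (- 1) ^ CARD('n)) :: rat)"
    by (simp only: card_traces)
  then show "rat_of_nat (HH0.dim (UNIV :: 'n HH0 set)) =
      2 / 3 * (2 ^ (CARD('n) - 1) - (- 1) ^ (CARD('n) - 1))"
    by (simp add: dim_HH0_UNIV m field_simps)
qed

end
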